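(* The universal conditional $\mathsf{IcOrdCMon}$-entropy of $\mathsf{FinCondProb}$ is the conditional Shannon entropy, i.e. the conditional entropy $(F,(h_{Q,f}))$ with values in $\mathbb{R}_{\ge0}$ (usual order and addition) given by $F(f)=H_1(P)-H_1(Q)$ for each morphism $f:P\to Q$ of $\mathsf{FinProb}$, and, for each $f:P\to Q$ and each object $P\xrightarrow{x}A\xrightarrow{a}Q$ (with $ax=f$) of $f/(\mathsf{FinProb}/Q)$, $$h_{Q,f}\big(P\xrightarrow{x}A\xrightarrow{a}Q\big)=H_1(A)-H_1(Q).$$
   Context: **FinProb.** Objects: strictly positive probability mass functions on finite sets; morphisms $P\to Q$: measure-preserving functions $f$, i.e. $Q(y)=\sum_{x\in f^{-1}(y)}P(x)$. $H_1(P)=-\sum_xP(x)\log P(x)$. **Conditional structure.** For $Q\in\mathsf{FinProb}$, the over category $\mathsf{FinProb}/Q$ (objects $f:P\to Q$) is monoidal under the conditional product: for $f_i:P_i\to Q$ ($i=1,2$), $f_1\otimes f_2:P\to Q$ where $P$ is the distribution on $\{(x_1,x_2):f_1(x_1)=f_2(x_2)\}$ with $P(x_1,x_2)=P_1(x_1)P_2(x_2)/Q(f_1(x_1))$ and $(f_1\otimes f_2)(x_1,x_2)=f_1(x_1)$; the unit is $\mathrm{id}_Q$. For $f:P\to Q$, the under category $N_Q(f):=f/(\mathsf{FinProb}/Q)$ has objects $X=(P\xrightarrow{x}A\xrightarrow{a}Q)$ with $ax=f$; morphisms to $(P\xrightarrow{x'}A'\xrightarrow{a'}Q)$ are $g:A\to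 A'$ with $gx=x'$, $a'g=a$. It is monoidal under the categorical product $X\times_f Y$ (the joint random variable $(x,y)$, with codomain the pushforward of $P$ on the image of $(x,y)$), with unit $I_f=(P\xrightarrow{f}Q\xrightarrow{\mathrm{id}}Q)$. For $g:Q\to Q'$, postcomposition sends $X=(P\xrightarrow{x}A\xrightarrow{a}Q)\in N_Q(f)$ to $g_*X=(P\xrightarrow{x}A\xrightarrow{ga}Q')\in N_{Q'}(gf)$. $\mathsf{FinCondProb}$ denotes $\mathsf{FinProb}$ together with all these data: each $Q$ is assigned the monoidal category $\mathsf{FinProb}/Q$ and the lax monoidal functor $N_Q=-/(\mathsf{FinProb}/Q)$ (acting on morphisms by precomposition, with coherence map the tensor product of $\mathsf{FinProb}/Q$), and each $g:Q\to Q'$ is assigned the (non-monoidal) postcomposition $g_*$. **Ordered monoids.** $\mathsf{IcOrdCMon}$: partially ordered commutative monoids $W$ (with $x\ge y,z\ge w\Rightarrow x+z\ge y+w$) that are integrally closed (if $nx+a\ge ny+b$ for all integers $n\ge1$, for some fixed $a,b$, then $x\ge y$), with order-preserving monoid homomorphisms. **Conditional entropies.** A conditional $\mathsf{IcOrdCMon}$-entropy of $\mathsf{FinCondProb}$ with values in $W\in\mathsf{IcOrdCMon}$ is a morphism from $\mathsf{FinCondProb}$ to $W$ in the category of discretely-indexed monoidal strictly-indexed monoidal categories. Unpacked, it consists of a map $F$ from morphisms of $\mathsf{FinProb}$ to $W$ with $F(\mathrm{id})=0$ and $F(gf)=F(g)+F(f)$, and, for each $Q$ and each $f:P\to Q$,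 a function $h_{Q,f}:\mathrm{Ob}(N_Q(f))\to W$, such that: (1) $h_{Q,f}(X)\ge h_{Q,f}(X')$ if there is a morphism $X\to X'$ in $N_Q(f)$; (2) $h_{Q,f}(X)+h_{Q,f}(Y)\ge h_{Q,f}(X\times_fY)$ and $0\ge h_{Q,f}(I_f)$; (3) $h_{Q,f'}(X\circ k)=h_{Q,f}(X)$ for every morphism $k:f'\to f$ in $\mathsf{FinProb}/Q$ and $X\in N_Q(f)$, where $X\circ k$ is precomposition of $x$ with $k$; (4) $h_{Q,f_1\otimes f_2}(X_1\otimes X_2)=h_{Q,f_1}(X_1)+h_{Q,f_2}(X_2)$ for $X_i\in N_Q(f_i)$, where $X_1\otimes X_2$ is the conditional product of the morphisms $X_1,X_2$ in $\mathsf{FinProb}/Q$; and $h_{Q,\mathrm{id}_Q}(\mathrm{id}_Q)=0$; (5) $F(g)+h_{Q,f}(X)=h_{Q',gf}(g_*X)$ for all $g:Q\to Q'$, $f:P\to Q$ and $X\in N_Q(f)$. It is universal if for every conditional $\mathsf{IcOrdCMon}$-entropy $(F',h')$ with values in $W'\in\mathsf{IcOrdCMon}$ there is a unique morphism $t:W\to W'$ in $\mathsf{IcOrdCMon}$ with $F'=t\circ F$ and $h'_{Q,f}=t\circ h_{Q,f}$ for all $Q,f$. *)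

theory Defs
  imports "HOL-Probability.Probability" "HOL-Library.Infinite_Typeclass"
    "HOL-Library.Nat_Bijection"
begin

text \<open>
  An ambient universe from whose elements the finite sets are formed. It is arbitrary, except that
  it is infinite and closed under (some choice of) ordered pairs, so that every finite set has a
  copy in it and finite subsets are closed under the products used below. A type of sets with
  Kuratowski pairs is an instance, and so is the type of natural numbers.
\<close>

class pairing_universe = infinite +
  fixes pair :: "'a \<times> 'a \<Rightarrow> 'a"
  assumes inj_pair: "inj pair"

instantiation nat :: pairing_universe
begin
definition pair_nat :: "nat \<times> nat \<Rightarrow> nat" where "pair_nat = prod_encode"
instance by standard (simp add: pair_nat_def inj_prod_encode)
end

definition unpair :: "'u::pairing_universe \<Rightarrow> 'u \<times> 'u" where
  "unpair = inv pair"

lemma unpair_pair [simp]: "unpair (pair z) = z"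
  by (simp add: unpair_def inj_pair)

text \<open>
  A strictly positive probability mass function on a finite set \<open>S\<close> is represented by the
  \<open>pmf\<close> with support \<open>S\<close>. Underlying functions of morphisms are extensional (undefined outside the
  support of the source), so that equality of arrows is equality of morphisms.
\<close>

definition FinProb_ob :: "'u pmf set" where
  "FinProb_ob = {P. finite (set_pmf P)}"

datatype 'u arr = Arr (src: "'u pmf") (tgt: "'u pmf") (app: "'u \<Rightarrow> 'u")

definition FinProb :: "'u arr set" where
  "FinProb = {f. src f \<in> FinProb_ob \<and> tgt f \<in> FinProb_ob \<and>
     app f \<in> set_pmf (src f) \<rightarrow>\<^sub>E set_pmf (tgt f) \<and> map_pmf (app f) (src f) = tgt f}"

definition ident :: "'u pmf \<Rightarrow> 'u arr" where
  "ident P = Arr P P (\<lambda>x\<in>set_pmf P. x)"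

definition comp_arr :: "'u arr \<Rightarrow> 'u arr \<Rightarrow> 'u arr"  (infixl "\<odot>" 75) where
  "g \<odot> f = Arr (src f) (tgt g) (compose (set_pmf (src f)) (app g) (app f))"

definition H1 :: "'u pmf \<Rightarrow> real" where
  "H1 P = - (\<Sum>x\<in>set_pmf P. pmf P x * ln (pmf P x))"

definition over_obs :: "'u pmf \<Rightarrow> 'u arr set" where
  "over_obs Q = {f \<in> FinProb. tgt f = Q}"

definition over_hom :: "'u arr \<Rightarrow> 'u arr \<Rightarrow> 'u arr set" where
  "over_hom f' f = {k \<in> FinProb. src k = src f' \<and> tgt k = src f \<and> f \<odot> k = f'}"

text \<open>
  The conditional product is meant for \<open>f1\<close>, \<open>f2\<close> with the same target \<open>Q\<close>. No guard is needed for
  points outside the supports, where the weight below vanishes.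
\<close>

definition cprod_weight :: "'u arr \<Rightarrow> 'u arr \<Rightarrow> 'u \<times> 'u \<Rightarrow> real" where
  "cprod_weight f1 f2 = (\<lambda>(x1, x2).
     if app f1 x1 = app f2 x2
     then pmf (src f1) x1 * pmf (src f2) x2 / pmf (tgt f1) (app f1 x1) else 0)"

definition cprod_pmf :: "'u::pairing_universe arr \<Rightarrow> 'u arr \<Rightarrow> 'u pmf" where
  "cprod_pmf f1 f2 = map_pmf pair (embed_pmf (cprod_weight f1 f2))"

definition tensor :: "'u::pairing_universe arr \<Rightarrow> 'u arr \<Rightarrow> 'u arr"  (infixl "\<otimes>" 70) where
  "f1 \<otimes> f2 = Arr (cprod_pmf f1 f2) (tgt f1)
     (\<lambda>z\<in>set_pmf (cprod_pmf f1 f2). app f1 (fst (unpair z)))"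

text \<open>
  Action of the conditional product on morphisms \<open>k1 : f1 \<rightarrow> g1\<close> and \<open>k2 : f2 \<rightarrow> g2\<close> over \<open>Q\<close>.
\<close>

definition tensor_hom ::
  "'u::pairing_universe arr \<Rightarrow> 'u arr \<Rightarrow> 'u arr \<Rightarrow> 'u arr \<Rightarrow> 'u arr \<Rightarrow> 'u arr \<Rightarrow> 'u arr" where
  "tensor_hom f1 f2 g1 g2 k1 k2 = Arr (cprod_pmf f1 f2) (cprod_pmf g1 g2)
     (\<lambda>z\<in>set_pmf (cprod_pmf f1 f2). pair (app k1 (fst (unpair z)), app k2 (snd (unpair z))))"

text \<open>
  For \<open>f : P \<rightarrow> Q\<close>, the pair \<open>(x, a)\<close> stands for the object \<open>P \<rightarrow> A \<rightarrow> Q\<close> of \<open>N\<^sub>Q(f)\<close>. The index \<open>Q\<close> is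
  left implicit throughout, because it is the target of \<open>f\<close>.
\<close>

type_synonym 'u under_ob = "'u arr \<times> 'u arr"

definition under_obs :: "'u arr \<Rightarrow> 'u under_ob set" where
  "under_obs f = {(x, a). x \<in> FinProb \<and> a \<in> FinProb \<and>
     src x = src f \<and> tgt x = src a \<and> tgt a = tgt f \<and> a \<odot> x = f}"

fun under_hom :: "'u under_ob \<Rightarrow> 'u under_ob \<Rightarrow> 'u arr set" where
  "under_hom (x, a) (x', a') =
     {g \<in> FinProb. src g = tgt x \<and> tgt g = tgt x' \<and> g \<odot> x = x' \<and> a' \<odot> g = a}"

definition under_unit :: "'u arr \<Rightarrow> 'u under_ob" where
  "under_unit f = (f, ident (tgt f))"

definition joint_pmf :: "'u::pairing_universe arr \<Rightarrow> 'u arr \<Rightarrow> 'u pmf" where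
  "joint_pmf x y = map_pmf (\<lambda>p. pair (app x p, app y p)) (src x)"

fun under_prod :: "'u::pairing_universe under_ob \<Rightarrow> 'u under_ob \<Rightarrow> 'u under_ob" where
  "under_prod (x, a) (y, b) =
     (Arr (src x) (joint_pmf x y) (\<lambda>p\<in>set_pmf (src x). pair (app x p, app y p)),
      Arr (joint_pmf x y) (tgt a) (\<lambda>z\<in>set_pmf (joint_pmf x y). app a (fst (unpair z))))"

fun under_precomp :: "'u under_ob \<Rightarrow> 'u arr \<Rightarrow> 'u under_ob" where
  "under_precomp (x, a) k = (x \<odot> k, a)"

fun under_postcomp :: "'u arr \<Rightarrow> 'u under_ob \<Rightarrow> 'u under_ob" where
  "under_postcomp g (x, a) = (x, g \<odot> a)"

text \<open>
  For objects \<open>(x1, a1)\<close> of \<open>N\<^sub>Q(f1)\<close> and \<open>(x2, a2)\<close> of \<open>N\<^sub>Q(f2)\<close>, \<open>xi\<close> is a morphism \<open>fi \<rightarrow> ai\<close> over \<open>Q\<close>.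
\<close>

fun under_tensor ::
  "'u::pairing_universe arr \<Rightarrow> 'u arr \<Rightarrow> 'u under_ob \<Rightarrow> 'u under_ob \<Rightarrow> 'u under_ob" where
  "under_tensor f1 f2 (x1, a1) (x2, a2) = (tensor_hom f1 f2 a1 a2 x1 x2, a1 \<otimes> a2)"

class ic_ord_cmon = ordered_comm_monoid_add +
  assumes integrally_closed:
    "(\<And>n::nat. n \<ge> 1 \<Longrightarrow> (\<Sum>i=1..n. y) + b \<le> (\<Sum>i=1..n. x) + a) \<Longrightarrow> y \<le> x"

definition ic_hom :: "('v::ic_ord_cmon \<Rightarrow> 'w::ic_ord_cmon) \<Rightarrow> bool" where
  "ic_hom t \<longleftrightarrow> mono t \<and> t 0 = 0 \<and> (\<forall>x y. t (x + y) = t x + t y)"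

typedef nnreal = "{x::real. 0 \<le> x}" morphisms real_of_nnreal Abs_nnreal
  by auto

setup_lifting type_definition_nnreal

instantiation nnreal :: ordered_comm_monoid_add
begin
lift_definition zero_nnreal :: nnreal is "0::real" by simp
lift_definition plus_nnreal :: "nnreal \<Rightarrow> nnreal \<Rightarrow> nnreal" is "(+) :: real \<Rightarrow> real \<Rightarrow> real" by simp
lift_definition less_eq_nnreal :: "nnreal \<Rightarrow> nnreal \<Rightarrow> bool" is "(\<le>) :: real \<Rightarrow> real \<Rightarrow> bool" .
lift_definition less_nnreal :: "nnreal \<Rightarrow> nnreal \<Rightarrow> bool" is "(<) :: real \<Rightarrow> real \<Rightarrow> bool" .
instance by standard (transfer; auto)+
end

instance nnreal :: ic_ord_cmon
proof
  fix x y a b :: nnreal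
  assume le: "\<And>n::nat. n \<ge> 1 \<Longrightarrow> (\<Sum>i=1..n. y) + b \<le> (\<Sum>i=1..n. x) + a"
  have sm: "real_of_nnreal (\<Sum>i=1..n. z) = n * real_of_nnreal z" for n :: nat and z
    by (induction n) (simp_all add: zero_nnreal.rep_eq plus_nnreal.rep_eq algebra_simps)
  have *: "n * real_of_nnreal y + real_of_nnreal b \<le> n * real_of_nnreal x + real_of_nnreal a"
    if "n \<ge> 1" for n :: nat
    using le[OF that] by (simp only: less_eq_nnreal.rep_eq plus_nnreal.rep_eq sm)
  show "y \<le> x"
  proof (rule ccontr)
    assume "\<not> y \<le> x"
    then have d: "real_of_nnreal y - real_of_nnreal x > 0" by (simp add: less_eq_nnreal.rep_eq)
    obtain n :: nat where n: "n * (real_of_nnreal y - real_of_nnreal x) > real_of_nnreal a"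
      using reals_Archimedean3[OF d] by blast
    have "real_of_nnreal b \<ge> 0" "real_of_nnreal a \<ge> 0" using real_of_nnreal by auto
    moreover from this n have "n \<ge> 1" by (cases n) auto
    ultimately show False using *[of n] n by (simp add: algebra_simps)
  qed
qed

locale cond_entropy =
  fixes F :: "'u::pairing_universe arr \<Rightarrow> 'w::ic_ord_cmon"
    and h :: "'u arr \<Rightarrow> 'u under_ob \<Rightarrow> 'w"
  assumes F_ident: "P \<in> FinProb_ob \<Longrightarrow> F (ident P) = 0"
    and F_comp: "f \<in> FinProb \<Longrightarrow> g \<in> FinProb \<Longrightarrow> src g = tgt f \<Longrightarrow> F (g \<odot> f) = F g + F f"
    and h_mono: "f \<in> FinProb \<Longrightarrow> X \<in> under_obs f \<Longrightarrow> X' \<in> under_obs f \<Longrightarrow> under_hom X X' \<noteq> {} \<Longrightarrow>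
      h f X' \<le> h f X"
    and h_prod: "f \<in> FinProb \<Longrightarrow> X \<in> under_obs f \<Longrightarrow> Y \<in> under_obs f \<Longrightarrow>
      h f (under_prod X Y) \<le> h f X + h f Y"
    and h_unit: "f \<in> FinProb \<Longrightarrow> h f (under_unit f) \<le> 0"
    and h_precomp: "f \<in> over_obs Q \<Longrightarrow> f' \<in> over_obs Q \<Longrightarrow> k \<in> over_hom f' f \<Longrightarrow> X \<in> under_obs f \<Longrightarrow>
      h f' (under_precomp X k) = h f X"
    and h_tensor: "f1 \<in> over_obs Q \<Longrightarrow> f2 \<in> over_obs Q \<Longrightarrow> X1 \<in> under_obs f1 \<Longrightarrow> X2 \<in> under_obs f2 \<Longrightarrow>
      h (f1 \<otimes> f2) (under_tensor f1 f2 X1 X2) = h f1 X1 + h f2 X2"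
    and h_tensor_unit: "Q \<in> FinProb_ob \<Longrightarrow> h (ident Q) (ident Q, ident Q) = 0"
    and h_postcomp: "f \<in> FinProb \<Longrightarrow> g \<in> FinProb \<Longrightarrow> src g = tgt f \<Longrightarrow> X \<in> under_obs f \<Longrightarrow>
      F g + h f X = h (g \<odot> f) (under_postcomp g X)"

text \<open>
  The differences of entropies below are nonnegative on the relevant arguments; see
  \<open>real_of_shannon_F\<close> and \<open>real_of_shannon_h\<close>.
\<close>

definition shannon_F :: "'u arr \<Rightarrow> nnreal" where
  "shannon_F f = Abs_nnreal (H1 (src f) - H1 (tgt f))"

fun shannon_h :: "'u arr \<Rightarrow> 'u under_ob \<Rightarrow> nnreal" where
  "shannon_h f (x, a) = Abs_nnreal (H1 (tgt x) - H1 (tgt f))"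

lemma pmf_tgt:
  assumes "f \<in> FinProb"
  shows "pmf (tgt f) y = (\<Sum>x | x \<in> set_pmf (src f) \<and> app f x = y. pmf (src f) x)"
proof -
  have fin: "finite (set_pmf (src f))" and m: "map_pmf (app f) (src f) = tgt f"
    using assms by (auto simp: FinProb_def FinProb_ob_def)
  have "pmf (tgt f) y = measure (src f) (app f -` {y})"
    unfolding m[symmetric] by (rule pmf_map)
  also have "\<dots> = measure (src f) (app f -` {y} \<inter> set_pmf (src f))"
    by (simp add: measure_Int_set_pmf)
  also have "app f -` {y} \<inter> set_pmf (src f) = {x. x \<in> set_pmf (src f) \<and> app f x = y}"
    by auto
  finally show ?thesis using fin by (simp add: measure_measure_pmf_finite)
qed

lemma FinProb_iff:
  "f \<in> FinProb \<longleftrightarrow> src f \<in> FinProb_ob \<and> tgt f \<in> FinProb_ob \<and>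
     app f \<in> set_pmf (src f) \<rightarrow>\<^sub>E set_pmf (tgt f) \<and>
     (\<forall>y\<in>set_pmf (tgt f). pmf (tgt f) y =
        (\<Sum>x | x \<in> set_pmf (src f) \<and> app f x = y. pmf (src f) x))" (is "_ \<longleftrightarrow> ?R")
proof
  assume "f \<in> FinProb"
  then show ?R using pmf_tgt[of f] by (auto simp: FinProb_def)
next
  assume R: ?R
  have fin: "finite (set_pmf (src f))" using R by (simp add: FinProb_ob_def)
  have "pmf (map_pmf (app f) (src f)) y = pmf (tgt f) y" for y
  proof -
    have "pmf (map_pmf (app f) (src f)) y = measure (src f) (app f -` {y} \<inter> set_pmf (src f))"
      by (simp add: pmf_map measure_Int_set_pmf)
    also have "app f -` {y} \<inter> set_pmf (src f) = {x. x \<in> set_pmf (src f) \<and> app f x = y}"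
      by auto
    also have "measure (src f) \<dots> = (\<Sum>x | x \<in> set_pmf (src f) \<and> app f x = y. pmf (src f) x)"
      using fin by (simp add: measure_measure_pmf_finite)
    also have "\<dots> = pmf (tgt f) y"
    proof (cases "y \<in> set_pmf (tgt f)")
      case True
      then show ?thesis using R by auto
    next
      case False
      then have "{x. x \<in> set_pmf (src f) \<and> app f x = y} = {}" using R by auto
      moreover have "pmf (tgt f) y = 0" using False by (simp add: set_pmf_iff)
      ultimately show ?thesis by (simp only: sum.empty)
    qed
    finally show ?thesis .
  qed
  then show "f \<in> FinProb" using R by (auto simp: FinProb_def intro: pmf_eqI)
qed

lemma H1_mono:
  assumes f: "f \<in> FinProb"
  shows "H1 (tgt f) \<le> H1 (src f)"
proof -
  let ?P = "src f" and ?Q = "tgt f"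
  have fin: "finite (set_pmf ?P)" "finite (set_pmf ?Q)" and im: "app f ` set_pmf ?P \<subseteq> set_pmf ?Q"
    using f by (auto simp: FinProb_def FinProb_ob_def)
  have "(\<Sum>y\<in>set_pmf ?Q. pmf ?Q y * ln (pmf ?Q y)) =
      (\<Sum>y\<in>set_pmf ?Q. \<Sum>x | x \<in> set_pmf ?P \<and> app f x = y. pmf ?P x * ln (pmf ?Q (app f x)))"
  proof (rule sum.cong[OF refl])
    fix y
    have "pmf ?Q y * ln (pmf ?Q y) =
        (\<Sum>x | x \<in> set_pmf ?P \<and> app f x = y. pmf ?P x) * ln (pmf ?Q y)"
      by (simp only: pmf_tgt[OF f, of y])
    also have "\<dots> = (\<Sum>x | x \<in> set_pmf ?P \<and> app f x = y. pmf ?P x * ln (pmf ?Q (app f x)))"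
      by (simp add: sum_distrib_right)
    finally show "pmf ?Q y * ln (pmf ?Q y) =
      (\<Sum>x | x \<in> set_pmf ?P \<and> app f x = y. pmf ?P x * ln (pmf ?Q (app f x)))" .
  qed
  also have "\<dots> = (\<Sum>x\<in>set_pmf ?P. pmf ?P x * ln (pmf ?Q (app f x)))"
    by (rule sum.group[OF fin im])
  also have "\<dots> \<ge> (\<Sum>x\<in>set_pmf ?P. pmf ?P x * ln (pmf ?P x))"
  proof (rule sum_mono)
    fix x assume x: "x \<in> set_pmf ?P"
    have "pmf ?P x \<le> pmf ?Q (app f x)"
      unfolding pmf_tgt[OF f, of "app f x"]
      by (rule member_le_sum) (use x fin in auto)
    moreover have "pmf ?P x > 0" using x by (simp add: pmf_positive)
    ultimately show "pmf ?P x * ln (pmf ?P x) \<le> pmf ?P x * ln (pmf ?Q (app f x))"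
      by (intro mult_left_mono) auto
  qed
  finally show ?thesis by (simp add: H1_def)
qed

lemma real_of_shannon_F:
  "f \<in> FinProb \<Longrightarrow> real_of_nnreal (shannon_F f) = H1 (src f) - H1 (tgt f)"
  using H1_mono[of f] by (simp add: shannon_F_def Abs_nnreal_inverse)

lemma real_of_shannon_h:
  assumes "(x, a) \<in> under_obs f"
  shows "real_of_nnreal (shannon_h f (x, a)) = H1 (tgt x) - H1 (tgt f)"
  using assms H1_mono[of a] by (auto simp: under_obs_def Abs_nnreal_inverse)

lemma sum_cprod_weight:
  assumes f: "f1 \<in> over_obs Q" "f2 \<in> over_obs Q"
  shows "(\<Sum>x2\<in>set_pmf (src f2). cprod_weight f1 f2 (x1, x2)) = pmf (src f1) x1"
proof (cases "x1 \<in> set_pmf (src f1)")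
  case x1: True
  have F: "f1 \<in> FinProb" "f2 \<in> FinProb" and Q: "tgt f1 = Q" "tgt f2 = Q"
    using f by (auto simp: over_obs_def)
  have fin: "finite (set_pmf (src f2))" and im: "app f1 x1 \<in> set_pmf Q"
    using F Q x1 by (auto simp: FinProb_def FinProb_ob_def)
  have "(\<Sum>x2\<in>set_pmf (src f2). cprod_weight f1 f2 (x1, x2)) =
      (\<Sum>x2 | x2 \<in> set_pmf (src f2) \<and> app f2 x2 = app f1 x1.
         pmf (src f1) x1 / pmf Q (app f1 x1) * pmf (src f2) x2)"
    using fin by (intro sum.mono_neutral_cong_right) (auto simp: cprod_weight_def Q)
  also have "\<dots> = pmf (src f1) x1 / pmf Q (app f1 x1) * pmf Q (app f1 x1)"
    using pmf_tgt[OF F(2), of "app f1 x1"] by (simp add: sum_distrib_left Q)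
  also have "\<dots> = pmf (src f1) x1" using im by (simp add: set_pmf_iff)
  finally show ?thesis .
next
  case False
  then have "pmf (src f1) x1 = 0" by (simp add: set_pmf_iff)
  then show ?thesis by (auto simp: cprod_weight_def intro!: sum.neutral)
qed

lemma pmf_embed_cprod_weight:
  assumes f: "f1 \<in> over_obs Q" "f2 \<in> over_obs Q"
  shows "pmf (embed_pmf (cprod_weight f1 f2)) z = cprod_weight f1 f2 z"
proof (rule pmf_embed_pmf)
  let ?w = "cprod_weight f1 f2"
  let ?S = "set_pmf (src f1) \<times> set_pmf (src f2)"
  have fin: "finite (set_pmf (src f1))" "finite (set_pmf (src f2))"
    using f by (auto simp: over_obs_def FinProb_def FinProb_ob_def)
  show nn: "0 \<le> ?w z" for z by (cases z) (simp add: cprod_weight_def)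
  have out: "?w z = 0" if "z \<notin> ?S" for z
    using that by (cases z) (auto simp: cprod_weight_def set_pmf_iff)
  have "(\<Sum>z\<in>?S. ?w z) = (\<Sum>x1\<in>set_pmf (src f1). \<Sum>x2\<in>set_pmf (src f2). ?w (x1, x2))"
    by (simp add: sum.cartesian_product)
  also have "\<dots> = 1"
    using fin by (simp add: sum_cprod_weight[OF f] sum_pmf_eq_1)
  finally have s1: "(\<Sum>z\<in>?S. ?w z) = 1" .
  have "(\<integral>\<^sup>+z. ennreal (?w z) \<partial>count_space UNIV) = (\<Sum>z\<in>?S. ennreal (?w z))"
    using fin out by (intro nn_integral_count_space') (auto simp del: mem_Sigma_iff)
  also have "\<dots> = 1" using nn s1 by (simp add: sum_ennreal)
  finally show "(\<integral>\<^sup>+z. ennreal (?w z) \<partial>count_space UNIV) = 1" .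
qed

lemma pmf_cprod_pmf:
  assumes f: "f1 \<in> over_obs Q" "f2 \<in> over_obs Q"
  shows "pmf (cprod_pmf f1 f2) (pair (x1, x2)) =
    (if app f1 x1 = app f2 x2 then pmf (src f1) x1 * pmf (src f2) x2 / pmf Q (app f1 x1) else 0)"
proof -
  have "pmf (cprod_pmf f1 f2) (pair (x1, x2)) = cprod_weight f1 f2 (x1, x2)"
    unfolding cprod_pmf_def pmf_map_inj'[OF inj_pair] by (rule pmf_embed_cprod_weight[OF f])
  then show ?thesis using f by (simp add: cprod_weight_def over_obs_def)
qed

lemma set_cprod_pmf:
  assumes f: "f1 \<in> over_obs Q" "f2 \<in> over_obs Q"
  shows "set_pmf (cprod_pmf f1 f2) =
    pair ` {(x1, x2). x1 \<in> set_pmf (src f1) \<and> x2 \<in> set_pmf (src f2) \<and> app f1 x1 = app f2 x2}"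
proof -
  let ?w = "cprod_weight f1 f2"
  have im: "pmf Q (app f1 x) \<noteq> 0" if "pmf (src f1) x \<noteq> 0" for x
    using f that by (auto simp: over_obs_def FinProb_def set_pmf_iff)
  have "set_pmf (embed_pmf ?w) = {z. ?w z \<noteq> 0}"
    by (auto simp: set_pmf_iff pmf_embed_cprod_weight[OF f])
  also have "\<dots> =
      {(x1, x2). x1 \<in> set_pmf (src f1) \<and> x2 \<in> set_pmf (src f2) \<and> app f1 x1 = app f2 x2}"
    using f im by (force simp: cprod_weight_def over_obs_def set_pmf_iff split: if_splits)
  finally show ?thesis by (simp add: cprod_pmf_def)
qed

lemma pmf_map_cprod_pmf:
  assumes f: "f1 \<in> over_obs Q" "f2 \<in> over_obs Q"
  shows "pmf (map_pmf r (cprod_pmf f1 f2)) y =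
    (\<Sum>x1\<in>set_pmf (src f1). \<Sum>x2\<in>set_pmf (src f2).
       if r (pair (x1, x2)) = y then cprod_weight f1 f2 (x1, x2) else 0)"
proof -
  let ?w = "cprod_weight f1 f2"
  let ?S = "set_pmf (src f1) \<times> set_pmf (src f2)"
  let ?V = "{z \<in> ?S. r (pair z) = y}"
  have fin: "finite ?S"
    using f by (auto simp: over_obs_def FinProb_def FinProb_ob_def)
  have sub: "set_pmf (embed_pmf ?w) \<subseteq> ?S"
    unfolding set_pmf_iff pmf_embed_cprod_weight[OF f] subset_iff
    by (auto simp: cprod_weight_def set_pmf_iff split: if_splits)
  have "pmf (map_pmf r (cprod_pmf f1 f2)) y = measure (embed_pmf ?w) ((r \<circ> pair) -` {y})"
    by (simp add: cprod_pmf_def map_pmf_comp pmf_map comp_def)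
  also have "\<dots> = measure (embed_pmf ?w) ?V"
    by (rule measure_eq_AE) (use sub in \<open>auto intro!: AE_pmfI\<close>)
  also have "\<dots> = (\<Sum>z\<in>?V. ?w z)"
    using fin by (simp add: measure_measure_pmf_finite pmf_embed_cprod_weight[OF f])
  also have "\<dots> = (\<Sum>z\<in>?S. if r (pair z) = y then ?w z else 0)"
    using fin by (rule sum.inter_filter)
  also have "\<dots> = (\<Sum>x1\<in>set_pmf (src f1). \<Sum>x2\<in>set_pmf (src f2).
       if r (pair (x1, x2)) = y then ?w (x1, x2) else 0)"
    unfolding sum.cartesian_product by (rule sum.cong) auto
  finally show ?thesis .
qed

lemma compose_map_pmf:
  "map_pmf (compose (set_pmf P) g f) P = map_pmf g (map_pmf f P)"
  unfolding map_pmf_comp by (rule map_pmf_cong) (auto simp: compose_def)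

lemma comp_arr_in_FinProb:
  "f \<in> FinProb \<Longrightarrow> g \<in> FinProb \<Longrightarrow> src g = tgt f \<Longrightarrow> g \<odot> f \<in> FinProb"
  by (auto simp: FinProb_def comp_arr_def compose_map_pmf) (auto simp: compose_def)

lemma tensor_in_over:
  assumes f: "f1 \<in> over_obs Q" "f2 \<in> over_obs Q"
  shows "f1 \<otimes> f2 \<in> over_obs Q"
proof -
  let ?P = "cprod_pmf f1 f2"
  let ?r = "\<lambda>z. app f1 (fst (unpair z))"
  have F: "f1 \<in> FinProb" and Q: "tgt f1 = Q" "Q \<in> FinProb_ob"
    and fin: "finite (set_pmf (src f1))" "finite (set_pmf (src f2))"
    using f by (auto simp: over_obs_def FinProb_def FinProb_ob_def)
  have "set_pmf ?P \<subseteq> pair ` (set_pmf (src f1) \<times> set_pmf (src f2))"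
    unfolding set_cprod_pmf[OF f] by auto
  then have finP: "finite (set_pmf ?P)" using fin by (auto intro: finite_subset)
  have "pmf (map_pmf ?r ?P) y = pmf Q y" for y
  proof -
    have "pmf (map_pmf ?r ?P) y = (\<Sum>x1\<in>set_pmf (src f1).
        if app f1 x1 = y then \<Sum>x2\<in>set_pmf (src f2). cprod_weight f1 f2 (x1, x2) else 0)"
      unfolding pmf_map_cprod_pmf[OF f] by (intro sum.cong) auto
    also have "\<dots> = (\<Sum>x1\<in>set_pmf (src f1). if app f1 x1 = y then pmf (src f1) x1 else 0)"
      by (simp only: sum_cprod_weight[OF f])
    also have "\<dots> = (\<Sum>x1 | x1 \<in> set_pmf (src f1) \<and> app f1 x1 = y. pmf (src f1) x1)"
      using fin by (simp add: sum.inter_filter)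
    also have "\<dots> = pmf Q y" by (simp add: pmf_tgt[OF F, unfolded Q])
    finally show ?thesis .
  qed
  then have "map_pmf ?r ?P = Q" by (rule pmf_eqI)
  moreover have "map_pmf (\<lambda>z\<in>set_pmf ?P. ?r z) ?P = map_pmf ?r ?P"
    by (rule map_pmf_cong) auto
  moreover have "?r ` set_pmf ?P \<subseteq> set_pmf Q"
    unfolding \<open>map_pmf ?r ?P = Q\<close>[symmetric] by simp
  ultimately show ?thesis
    using finP Q by (auto simp: tensor_def over_obs_def FinProb_def FinProb_ob_def)
qed

lemma map_cprod_pmf:
  assumes f: "f1 \<in> over_obs Q" "f2 \<in> over_obs Q" and g: "g1 \<in> over_obs Q" "g2 \<in> over_obs Q"
    and k: "k1 \<in> over_hom f1 g1" "k2 \<in> over_hom f2 g2"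
  shows "map_pmf (\<lambda>z. pair (app k1 (fst (unpair z)), app k2 (snd (unpair z)))) (cprod_pmf f1 f2) =
    cprod_pmf g1 g2" (is "map_pmf ?r _ = _")
proof (rule pmf_eqI)
  fix u
  have K: "k1 \<in> FinProb" "k2 \<in> FinProb"
    and s: "src k1 = src f1" "src k2 = src f2" "tgt k1 = src g1" "tgt k2 = src g2"
    and c: "g1 \<odot> k1 = f1" "g2 \<odot> k2 = f2"
    using k by (auto simp: over_hom_def)
  have Q: "tgt f1 = Q" "tgt g1 = Q" using f g by (auto simp: over_obs_def)
  have a: "app f1 x = app g1 (app k1 x)" if "x \<in> set_pmf (src f1)" for x
    using c(1) s that by (metis arr.sel(3) comp_arr_def compose_eq)
  have b: "app f2 x = app g2 (app k2 x)" if "x \<in> set_pmf (src f2)" for x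
    using c(2) s that by (metis arr.sel(3) comp_arr_def compose_eq)
  have fin: "finite (set_pmf (src f1))" "finite (set_pmf (src f2))"
    using f by (auto simp: over_obs_def FinProb_def FinProb_ob_def)
  show "pmf (map_pmf ?r (cprod_pmf f1 f2)) u = pmf (cprod_pmf g1 g2) u"
  proof (cases "u \<in> range pair")
    case False
    then have "u \<notin> set_pmf (cprod_pmf g1 g2)" "u \<notin> set_pmf (map_pmf ?r (cprod_pmf f1 f2))"
      by (auto simp: cprod_pmf_def)
    then show ?thesis by (simp only: set_pmf_iff not_not)
  next
    case True
    then obtain y1 y2 where u: "u = pair (y1, y2)" by auto
    let ?c = "if app g1 y1 = app g2 y2 then 1 / pmf Q (app g1 y1) else 0"
    have "pmf (map_pmf ?r (cprod_pmf f1 f2)) u =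
      (\<Sum>x1\<in>set_pmf (src f1). \<Sum>x2\<in>set_pmf (src f2).
        (if app k1 x1 = y1 then pmf (src f1) x1 else 0) *
        (if app k2 x2 = y2 then pmf (src f2) x2 else 0) * ?c)"
      unfolding pmf_map_cprod_pmf[OF f] u
      by (intro sum.cong refl) (auto simp: inj_eq[OF inj_pair] cprod_weight_def a b Q)
    also have "\<dots> = (\<Sum>x1\<in>set_pmf (src f1). if app k1 x1 = y1 then pmf (src f1) x1 else 0) *
        (\<Sum>x2\<in>set_pmf (src f2). if app k2 x2 = y2 then pmf (src f2) x2 else 0) * ?c"
      unfolding sum_product by (simp only: sum_distrib_right)
    also have "\<dots> = pmf (src g1) y1 * pmf (src g2) y2 * ?c"
      using fin pmf_tgt[OF K(1), of y1] pmf_tgt[OF K(2), of y2]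
      by (simp only: sum.inter_filter s)
    also have "\<dots> = pmf (cprod_pmf g1 g2) u"
      by (simp add: u pmf_cprod_pmf[OF g])
    finally show ?thesis .
  qed
qed

lemma tensor_hom_in_over_hom:
  assumes f: "f1 \<in> over_obs Q" "f2 \<in> over_obs Q" and g: "g1 \<in> over_obs Q" "g2 \<in> over_obs Q"
    and k: "k1 \<in> over_hom f1 g1" "k2 \<in> over_hom f2 g2"
  shows "tensor_hom f1 f2 g1 g2 k1 k2 \<in> over_hom (f1 \<otimes> f2) (g1 \<otimes> g2)"
proof -
  let ?P = "cprod_pmf f1 f2"
  let ?r = "\<lambda>z. pair (app k1 (fst (unpair z)), app k2 (snd (unpair z)))"
  have m: "map_pmf ?r ?P = cprod_pmf g1 g2" by (rule map_cprod_pmf[OF f g k])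
  have m': "map_pmf (\<lambda>z\<in>set_pmf ?P. ?r z) ?P = map_pmf ?r ?P"
    by (rule map_pmf_cong) auto
  have im: "?r z \<in> set_pmf (cprod_pmf g1 g2)" if "z \<in> set_pmf ?P" for z
    unfolding m[symmetric] using that by simp
  have ob: "finite (set_pmf ?P)" "finite (set_pmf (cprod_pmf g1 g2))"
    using tensor_in_over[OF f] tensor_in_over[OF g]
    by (auto simp: over_obs_def FinProb_def FinProb_ob_def tensor_def)
  have c: "g1 \<odot> k1 = f1" and s: "src k1 = src f1" using k by (auto simp: over_hom_def)
  have a: "app f1 x = app g1 (app k1 x)" if "x \<in> set_pmf (src f1)" for x
    using c s that by (metis arr.sel(3) comp_arr_def compose_eq)
  have "compose (set_pmf ?P) (app (g1 \<otimes> g2)) (\<lambda>z\<in>set_pmf ?P. ?r z) = app (f1 \<otimes> f2)"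
  proof
    fix z
    show "compose (set_pmf ?P) (app (g1 \<otimes> g2)) (\<lambda>z\<in>set_pmf ?P. ?r z) z = app (f1 \<otimes> f2) z"
    proof (cases "z \<in> set_pmf ?P")
      case True
      then have "fst (unpair z) \<in> set_pmf (src f1)" by (auto simp: set_cprod_pmf[OF f])
      then show ?thesis using True im[OF True] by (simp add: compose_def tensor_def a)
    qed (simp add: compose_def tensor_def)
  qed
  moreover have "tgt f1 = tgt g1" using f g by (simp add: over_obs_def)
  ultimately show ?thesis
    using ob m m' im
    by (auto simp: over_hom_def tensor_hom_def FinProb_def FinProb_ob_def tensor_def comp_arr_def)
qed

lemma under_tensor_in_under:
  assumes f: "f1 \<in> over_obs Q" "f2 \<in> over_obs Q" and X: "X1 \<in> under_obs f1" "X2 \<in> under_obs f2"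
  shows "under_tensor f1 f2 X1 X2 \<in> under_obs (f1 \<otimes> f2)"
proof -
  obtain x1 a1 x2 a2 where eq: "X1 = (x1, a1)" "X2 = (x2, a2)" by (metis surj_pair)
  have a: "a1 \<in> over_obs Q" "a2 \<in> over_obs Q" and x: "x1 \<in> over_hom f1 a1" "x2 \<in> over_hom f2 a2"
    using f X unfolding eq by (auto simp: under_obs_def over_obs_def over_hom_def)
  have "a1 \<otimes> a2 \<in> FinProb" "tgt a1 = tgt f1"
    using tensor_in_over[OF a] a f by (auto simp: over_obs_def)
  then show ?thesis
    using tensor_hom_in_over_hom[OF f a x]
    by (simp add: eq under_obs_def over_hom_def tensor_hom_def tensor_def)
qed

lemma under_prod_in_under:
  assumes f: "f \<in> FinProb" and X: "X \<in> under_obs f" and Y: "Y \<in> under_obs f"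
  shows "under_prod X Y \<in> under_obs f"
proof -
  obtain x a y b where eq: "X = (x, a)" "Y = (y, b)" by (metis surj_pair)
  have x: "x \<in> FinProb" and a: "a \<in> FinProb" and s: "src x = src f" "tgt x = src a" "tgt a = tgt f"
    and c: "a \<odot> x = f"
    using X by (auto simp: eq under_obs_def)
  let ?J = "joint_pmf x y"
  let ?u = "\<lambda>p. pair (app x p, app y p)" and ?v = "\<lambda>z. app a (fst (unpair z))"
  have fx: "app f p = app a (app x p)" if "p \<in> set_pmf (src f)" for p
    using c s that by (metis arr.sel(3) comp_arr_def compose_eq)
  have mu: "map_pmf (\<lambda>p\<in>set_pmf (src f). ?u p) (src f) = ?J"
    unfolding joint_pmf_def s by (rule map_pmf_cong) auto
  have J: "set_pmf ?J = ?u ` set_pmf (src f)" by (simp add: joint_pmf_def s)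
  have "map_pmf (\<lambda>z\<in>set_pmf ?J. ?v z) ?J = map_pmf ?v ?J"
    by (rule map_pmf_cong) auto
  also have "\<dots> = map_pmf (app f) (src f)"
    unfolding joint_pmf_def map_pmf_comp s by (rule map_pmf_cong) (auto simp: fx)
  also have "\<dots> = tgt f" using f by (simp add: FinProb_def)
  finally have mv: "map_pmf (\<lambda>z\<in>set_pmf ?J. ?v z) ?J = tgt f" .
  have fs: "finite (set_pmf (src f))" "finite (set_pmf (tgt f))"
    and ft: "app f \<in> set_pmf (src f) \<rightarrow>\<^sub>E set_pmf (tgt f)"
    using f by (auto simp: FinProb_def FinProb_ob_def)
  have cmp: "compose (set_pmf (src f)) (\<lambda>z\<in>set_pmf ?J. ?v z) (\<lambda>p\<in>set_pmf (src f). ?u p) = app f"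
    using ft by (auto simp: compose_def J fx fun_eq_iff PiE_def extensional_def)
  show ?thesis
    unfolding eq under_obs_def
    using fs ft mu mv cmp J
    by (cases f) (auto simp: s FinProb_def FinProb_ob_def comp_arr_def fx[symmetric])
qed

end

theory Submission
  imports Defs "HOL-Real_Asymp.Real_Asymp"
begin

text \<open>
  For the Shannon entropy, submodularity is Gibbs' inequality against the conditional product.

  For universality, monotonicity, precomposition and postcomposition force \<open>h f (x, a) = F a\<close>, and
  \<open>F f\<close> is the difference of the entropies \<open>F (P \<rightarrow> pt)\<close> of its source and target. The conditional
  product makes \<open>F\<close> additive over the fibres of a map, and together with submodularity this
  gives the chain rule and concavity. Hence the values at uniform distributions are additive and
  monotone, the chain rule expresses the value at a rational distribution through them exactly as
  for the Shannon entropy, and concavity squeezes an arbitrary distribution between rational ones.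
  So \<open>a H\<^sub>1(P) < b ln 2\<close> implies that \<open>a\<close> times the entropy of \<open>P\<close> is at most \<open>b\<close> times that of a fair bit,
  and conversely with the inequalities reversed; by integral closedness the entropy
  of \<open>P\<close> is a monotone function of \<open>H\<^sub>1(P)\<close>.
\<close>

subsection \<open>Multiples in integrally closed ordered monoids\<close>

text \<open>Values lie in a commutative monoid without scalars or subtraction, so a comparison with
  a rational ratio is stated between natural multiples.\<close>

definition nmult :: "nat \<Rightarrow> 'w::comm_monoid_add \<Rightarrow> 'w"  (infixr "\<circledast>" 75) where
  "n \<circledast> x = (\<Sum>i<n. x)"

lemma nmult_0 [simp]: "0 \<circledast> x = 0"
  and nmult_Suc [simp]: "Suc n \<circledast> x = x + n \<circledast> x"
  and nmult_zero [simp]: "n \<circledast> 0 = 0"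
  by (simp_all add: nmult_def add.commute)

lemma nmult_add: "(m + n) \<circledast> x = m \<circledast> x + n \<circledast> x"
  by (induction m) (simp_all add: add.assoc)

lemma nmult_add_right: "n \<circledast> (x + y) = n \<circledast> x + n \<circledast> y"
  by (simp add: nmult_def sum.distrib)

lemma nmult_mult: "(m * n) \<circledast> x = m \<circledast> n \<circledast> x"
  by (induction m) (simp_all add: nmult_add)

lemma nmult_left_commute: "m \<circledast> n \<circledast> x = n \<circledast> m \<circledast> x"
  by (metis nmult_mult mult.commute)

lemma sum_const_nmult: "(\<Sum>i\<in>A. x) = card A \<circledast> x"
  by (induction A rule: infinite_finite_induct) simp_all

lemma nmult_sum: "n \<circledast> (\<Sum>i\<in>A. f i) = (\<Sum>i\<in>A. n \<circledast> f i)"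
  by (induction A rule: infinite_finite_induct) (simp_all add: nmult_add_right)

lemma nmult_mono: "x \<le> y \<Longrightarrow> n \<circledast> x \<le> n \<circledast> y" for x :: "'w::ordered_comm_monoid_add"
  unfolding nmult_def by (rule sum_mono)

lemma nmult_nonneg: "0 \<le> x \<Longrightarrow> 0 \<le> n \<circledast> x" for x :: "'w::ordered_comm_monoid_add"
  unfolding nmult_def by (rule sum_nonneg)

lemma nmult_mono_left:
  fixes x :: "'w::ordered_comm_monoid_add"
  assumes "0 \<le> x" "m \<le> n"
  shows "m \<circledast> x \<le> n \<circledast> x"
  using add_left_mono[OF nmult_nonneg[OF assms(1), of "n - m"], of "m \<circledast> x"] assms(2)
  by (simp flip: nmult_add)

text \<open>The form of integral closedness used below: multiples need only be compared up to an
  error that stays fixed as n grows.\<close>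

lemma ic_leI:
  fixes x y :: "'w::ic_ord_cmon"
  assumes "\<And>n. n \<circledast> y + b \<le> n \<circledast> x + a"
  shows "y \<le> x"
  by (rule integrally_closed[of y b x a]) (use assms in \<open>simp add: sum_const_nmult\<close>)

text \<open>Iterating the hypothesis trades one x for one y at a time while keeping a single z. That
  z is the fixed error term of \<open>ic_leI\<close>.\<close>

lemma ic_add_le_cancel: "x + z \<le> y + z \<longleftrightarrow> x \<le> y" for x y z :: "'w::ic_ord_cmon"
proof
  assume le: "x + z \<le> y + z"
  have "n \<circledast> x + z \<le> n \<circledast> y + z" for n
  proof (induction n)
    case (Suc n)
    have "Suc n \<circledast> x + z \<le> x + (n \<circledast> y + z)"
      using add_left_mono[OF Suc, of x] by (simp add: add.assoc)
    also have "\<dots> = n \<circledast> y + (x + z)" by (simp add: add_ac)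
    also have "\<dots> \<le> Suc n \<circledast> y + z"
      using add_left_mono[OF le, of "n \<circledast> y"] by (simp add: add_ac)
    finally show ?case .
  qed simp
  then show "x \<le> y" by (rule ic_leI)
qed (rule add_right_mono)

lemma ic_add_eq_cancel: "x + z = y + z \<longleftrightarrow> x = y" for x y z :: "'w::ic_ord_cmon"
  by (auto simp: order_eq_iff ic_add_le_cancel)

lemma ic_add_eq_cancel_left: "z + x = z + y \<longleftrightarrow> x = y" for x y z :: "'w::ic_ord_cmon"
  using ic_add_eq_cancel[of x z y] by (simp add: add.commute)

lemma ic_add_le_cancel_left: "z + x \<le> z + y \<longleftrightarrow> x \<le> y" for x y z :: "'w::ic_ord_cmon"
  using ic_add_le_cancel[of x z y] by (simp add: add.commute)

text \<open>Division of n by N with remainder: the quotient part is compared by hypothesis, and the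
  remainder costs at most N copies of x, an error independent of n.\<close>

lemma nmult_le_cancel:
  fixes x y :: "'w::ic_ord_cmon"
  assumes le: "N \<circledast> x \<le> N \<circledast> y" and "0 < N" "0 \<le> x" "0 \<le> y"
  shows "x \<le> y"
proof (rule ic_leI)
  fix n
  have "n \<circledast> x = (n div N) \<circledast> N \<circledast> x + (n mod N) \<circledast> x"
    by (simp flip: nmult_add nmult_mult)
  also have "\<dots> \<le> (n div N) \<circledast> N \<circledast> y + N \<circledast> x"
    using assms by (intro add_mono nmult_mono[OF le] nmult_mono_left) auto
  also have "\<dots> \<le> n \<circledast> y + N \<circledast> x"
    using assms by (intro add_right_mono) (simp add: nmult_mono_left flip: nmult_mult)
  finally show "n \<circledast> x + 0 \<le> n \<circledast> y + N \<circledast> x" by simp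
qed

subsection \<open>The Shannon entropy\<close>

lemma sum_map_pmf:
  fixes g :: "'b \<Rightarrow> real"
  assumes "finite (set_pmf P)"
  shows "(\<Sum>y\<in>set_pmf (map_pmf f P). pmf (map_pmf f P) y * g y) = (\<Sum>x\<in>set_pmf P. pmf P x * g (f x))"
proof -
  have "(\<Sum>y\<in>set_pmf (map_pmf f P). pmf (map_pmf f P) y * g y) = measure_pmf.expectation (map_pmf f P) g"
    using assms by (subst integral_measure_pmf_real[of "set_pmf (map_pmf f P)"])
      (auto simp: mult.commute)
  also have "\<dots> = measure_pmf.expectation P (\<lambda>x. g (f x))" by simp
  also have "\<dots> = (\<Sum>x\<in>set_pmf P. pmf P x * g (f x))"
    using assms by (subst integral_measure_pmf_real[of "set_pmf P"]) (auto simp: mult.commute)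
  finally show ?thesis .
qed

text \<open>Writes the entropies of all marginals as sums over one common distribution, so that
  entropy identities can be checked under a single sum.\<close>

lemma H1_map:
  "finite (set_pmf P) \<Longrightarrow>
    H1 (map_pmf f P) = - (\<Sum>x\<in>set_pmf P. pmf P x * ln (pmf (map_pmf f P) (f x)))"
  unfolding H1_def by (subst sum_map_pmf) simp_all

lemma H1_map_inj:
  assumes "inj_on f (set_pmf P)"
  shows "H1 (map_pmf f P) = H1 P"
  using assms by (simp add: H1_def sum.reindex pmf_map_inj)

lemma H1_superset:
  "finite S \<Longrightarrow> set_pmf P \<subseteq> S \<Longrightarrow> H1 P = - (\<Sum>x\<in>S. pmf P x * ln (pmf P x))"
  unfolding H1_def by (subst sum.mono_neutral_left[of S "set_pmf P"]) (auto simp: set_pmf_iff)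

lemma H1_return [simp]: "H1 (return_pmf x) = 0"
  by (simp add: H1_def)

lemma H1_nonneg: "0 \<le> H1 P"
  unfolding H1_def neg_0_le_iff_le
  by (rule sum_nonpos) (auto simp: mult_le_0_iff pmf_le_1 pmf_positive)

text \<open>Termwise, this is ln u <= u - 1 at u = C(x) / P(x), weighted by P(x).\<close>

lemma gibbs_inequality:
  assumes fin: "finite (set_pmf P)" and sub: "set_pmf P \<subseteq> set_pmf C"
  shows "(\<Sum>x\<in>set_pmf P. pmf P x * ln (pmf C x)) \<le> - H1 P"
proof -
  have "pmf P x * ln (pmf C x) - pmf P x * ln (pmf P x) \<le> pmf C x - pmf P x"
    if "x \<in> set_pmf P" for x
  proof -
    have pos: "0 < pmf P x" "0 < pmf C x" using that sub by (auto simp: pmf_positive)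
    then have "pmf P x * (ln (pmf C x) - ln (pmf P x)) \<le> pmf P x * (pmf C x / pmf P x - 1)"
      using ln_le_minus_one[of "pmf C x / pmf P x"] by (simp add: ln_div)
    then show ?thesis using pos by (simp add: algebra_simps)
  qed
  then have "(\<Sum>x\<in>set_pmf P. pmf P x * ln (pmf C x)) - (\<Sum>x\<in>set_pmf P. pmf P x * ln (pmf P x))
      \<le> (\<Sum>x\<in>set_pmf P. pmf C x) - (\<Sum>x\<in>set_pmf P. pmf P x)"
    unfolding sum_subtractf[symmetric] by (rule sum_mono)
  \<comment> \<open>C may charge points outside the support of P, so its mass on that support is
    only known to be at most 1.\<close>
  also have "\<dots> \<le> 0"
    using fin measure_measure_pmf_finite[OF fin, of C] measure_pmf.prob_le_1[of C "set_pmf P"]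
    by (simp add: sum_pmf_eq_1)
  finally show ?thesis by (simp add: H1_def)
qed

section \<open>Marginals and Shannon entropy of conditional products\<close>

lemma map_fst_cprod_pmf:
  assumes f: "f1 \<in> over_obs Q" "f2 \<in> over_obs Q"
  shows "map_pmf (\<lambda>z. fst (unpair z)) (cprod_pmf f1 f2) = src f1"
proof (rule pmf_eqI)
  fix y
  have fin: "finite (set_pmf (src f1))"
    using f by (auto simp: over_obs_def FinProb_def FinProb_ob_def)
  have "pmf (map_pmf (\<lambda>z. fst (unpair z)) (cprod_pmf f1 f2)) y = (\<Sum>x1\<in>set_pmf (src f1).
      if x1 = y then \<Sum>x2\<in>set_pmf (src f2). cprod_weight f1 f2 (x1, x2) else 0)"
    unfolding pmf_map_cprod_pmf[OF f] by (intro sum.cong) auto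
  also have "\<dots> = pmf (src f1) y"
    unfolding sum_cprod_weight[OF f] using fin by (simp add: set_pmf_iff)
  finally show "pmf (map_pmf (\<lambda>z. fst (unpair z)) (cprod_pmf f1 f2)) y = pmf (src f1) y" .
qed

text \<open>One pointwise inequality suffices: two probability mass functions, one below the other,
  are equal because both have total mass 1.\<close>

lemma cprod_pmf_swap:
  assumes f: "f1 \<in> over_obs Q" "f2 \<in> over_obs Q"
  shows "cprod_pmf f2 f1 = map_pmf (\<lambda>z. pair (prod.swap (unpair z))) (cprod_pmf f1 f2)"
    (is "_ = map_pmf ?s _")
proof -
  have inj: "inj_on ?s (set_pmf (cprod_pmf f1 f2))"
    by (auto simp: inj_on_def set_cprod_pmf[OF f] inj_eq[OF inj_pair])
  have le: "pmf (cprod_pmf f1 f2) z \<le> pmf (cprod_pmf f2 f1) (?s z)" if "z \<in> range pair" for z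
    using that by (auto simp: pmf_cprod_pmf[OF f] pmf_cprod_pmf[OF f(2,1)] mult.commute)
  have "pmf (map_pmf ?s (cprod_pmf f1 f2)) y \<le> pmf (cprod_pmf f2 f1) y" for y
  proof (cases "y \<in> ?s ` set_pmf (cprod_pmf f1 f2)")
    case True
    then obtain z where "z \<in> set_pmf (cprod_pmf f1 f2)" "y = ?s z" by auto
    moreover from this have "z \<in> range pair" by (auto simp: set_cprod_pmf[OF f])
    ultimately show ?thesis using le[of z] pmf_map_inj[OF inj, of z] by simp
  next
    case False
    then have "pmf (map_pmf ?s (cprod_pmf f1 f2)) y = 0" by (simp flip: set_map_pmf add: set_pmf_iff)
    then show ?thesis by simp
  qed
  then show ?thesis using pmf_neq_exists_less by (metis linorder_not_le)
qed

lemma map_snd_cprod_pmf: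
  assumes f: "f1 \<in> over_obs Q" "f2 \<in> over_obs Q"
  shows "map_pmf (\<lambda>z. snd (unpair z)) (cprod_pmf f1 f2) = src f2"
  unfolding map_fst_cprod_pmf[OF f(2,1), symmetric] cprod_pmf_swap[OF f] map_pmf_comp by simp

lemma FinProb_map_pmf: "f \<in> FinProb \<Longrightarrow> map_pmf (app f) (src f) = tgt f"
  by (simp add: FinProb_def)

lemma ln_pmf_cprod_pmf:
  assumes f: "f1 \<in> over_obs Q" "f2 \<in> over_obs Q"
    and x: "x1 \<in> set_pmf (src f1)" "x2 \<in> set_pmf (src f2)" "app f1 x1 = app f2 x2"
  shows "ln (pmf (cprod_pmf f1 f2) (pair (x1, x2))) =
    ln (pmf (src f1) x1) + ln (pmf (src f2) x2) - ln (pmf Q (app f1 x1))"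
proof -
  have "app f1 x1 \<in> set_pmf Q" using f x by (auto simp: over_obs_def FinProb_def)
  then have "pmf Q (app f1 x1) > 0" "pmf (src f1) x1 > 0" "pmf (src f2) x2 > 0"
    using x by (simp_all add: pmf_positive)
  then show ?thesis using x by (simp add: pmf_cprod_pmf[OF f] ln_div ln_mult)
qed

lemma finite_FinProb: "f \<in> FinProb \<Longrightarrow> finite (set_pmf (src f)) \<and> finite (set_pmf (tgt f))"
  by (auto simp: FinProb_def FinProb_ob_def)

text \<open>The logarithm of the weight P1 P2 / Q splits into three terms, and averaging each over
  the conditional product gives the entropy of a marginal.\<close>

lemma H1_cprod_pmf:
  assumes f: "f1 \<in> over_obs Q" "f2 \<in> over_obs Q"
  shows "H1 (cprod_pmf f1 f2) + H1 Q = H1 (src f1) + H1 (src f2)"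
proof -
  let ?C = "cprod_pmf f1 f2"
  have T: "src (f1 \<otimes> f2) = ?C" by (simp add: tensor_def)
  have fin: "finite (set_pmf ?C)" using tensor_in_over[OF f] finite_FinProb[of "f1 \<otimes> f2"] T
    by (auto simp: over_obs_def)
  have mQ: "map_pmf (\<lambda>z. app f1 (fst (unpair z))) ?C = Q"
    using map_pmf_comp[of "app f1" "\<lambda>z. fst (unpair z)" ?C] f(1)
    by (simp add: map_fst_cprod_pmf[OF f] over_obs_def FinProb_map_pmf)
  have "H1 ?C = - (\<Sum>z\<in>set_pmf ?C. pmf ?C z * (ln (pmf (src f1) (fst (unpair z)))
      + ln (pmf (src f2) (snd (unpair z))) - ln (pmf Q (app f1 (fst (unpair z))))))"
    unfolding H1_def
    by (rule arg_cong[where f = uminus], rule sum.cong)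
       (auto simp: set_cprod_pmf[OF f] ln_pmf_cprod_pmf[OF f])
  also have "\<dots> = H1 (src f1) + H1 (src f2) - H1 Q"
    using H1_map[OF fin, of "\<lambda>z. fst (unpair z)"] H1_map[OF fin, of "\<lambda>z. snd (unpair z)"]
      H1_map[OF fin, of "\<lambda>z. app f1 (fst (unpair z))"]
    by (simp add: map_fst_cprod_pmf[OF f] map_snd_cprod_pmf[OF f] mQ
        algebra_simps sum.distrib sum_subtractf)
  finally show ?thesis by simp
qed

text \<open>Gibbs' inequality for the joint distribution against the conditional product.\<close>

lemma H1_joint_pmf:
  assumes X: "(x, a) \<in> under_obs f" and Y: "(y, b) \<in> under_obs f"
  shows "H1 (joint_pmf x y) + H1 (tgt f) \<le> H1 (tgt x) + H1 (tgt y)"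
proof -
  have x: "x \<in> FinProb" "y \<in> FinProb" and s: "src x = src f" "src y = src f" "tgt x = src a" "tgt y = src b"
    and ab: "a \<in> over_obs (tgt f)" "b \<in> over_obs (tgt f)" and c: "a \<odot> x = f" "b \<odot> y = f"
    using X Y by (auto simp: under_obs_def over_obs_def)
  let ?P = "src f" and ?C = "cprod_pmf a b" and ?J = "joint_pmf x y"
  let ?u = "\<lambda>p. pair (app x p, app y p)"
  have fin: "finite (set_pmf ?P)" using finite_FinProb[OF x(1)] s by simp
  have J: "?J = map_pmf ?u ?P" by (simp add: joint_pmf_def s)
  have ax: "app a (app x p) = app f p" "app b (app y p) = app f p" if "p \<in> set_pmf ?P" for p
    using c s that by (metis arr.sel(3) comp_arr_def compose_eq)+
  have im: "app x p \<in> set_pmf (src a)" "app y p \<in> set_pmf (src b)" if "p \<in> set_pmf ?P" for p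
    using x s that by (auto simp: FinProb_def)
  have mx: "map_pmf (app x) ?P = tgt x" "map_pmf (app y) ?P = tgt y"
    using x s FinProb_map_pmf by metis+
  have "f \<in> FinProb"
    using comp_arr_in_FinProb[OF x(1), of a] ab s c by (auto simp: over_obs_def)
  then have mf: "map_pmf (app f) ?P = tgt f" by (rule FinProb_map_pmf)
  have "(\<Sum>z\<in>set_pmf ?J. pmf ?J z * ln (pmf ?C z)) = (\<Sum>p\<in>set_pmf ?P. pmf ?P p * ln (pmf ?C (?u p)))"
    unfolding J by (rule sum_map_pmf[OF fin])
  also have "\<dots> = (\<Sum>p\<in>set_pmf ?P. pmf ?P p * (ln (pmf (tgt x) (app x p)) +
      ln (pmf (tgt y) (app y p)) - ln (pmf (tgt f) (app f p))))"
    by (rule sum.cong[OF refl]) (simp add: ln_pmf_cprod_pmf[OF ab] im ax s)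
  also have "\<dots> = H1 (tgt f) - H1 (tgt x) - H1 (tgt y)"
    using H1_map[OF fin, of "app x"] H1_map[OF fin, of "app y"] H1_map[OF fin, of "app f"]
    by (simp add: mx mf algebra_simps sum.distrib sum_subtractf)
  finally have "(\<Sum>z\<in>set_pmf ?J. pmf ?J z * ln (pmf ?C z)) = H1 (tgt f) - H1 (tgt x) - H1 (tgt y)" .
  \<comment> \<open>Gibbs' inequality applies because a x = f = b y places the support of the joint
    distribution inside the fibre product.\<close>
  moreover have "(\<Sum>z\<in>set_pmf ?J. pmf ?J z * ln (pmf ?C z)) \<le> - H1 ?J"
    using fin im ax by (intro gibbs_inequality) (auto simp: J set_cprod_pmf[OF ab])
  ultimately show ?thesis by simp
qed

lemma real_of_nnreal_shannon_h:
  "X \<in> under_obs f \<Longrightarrow> real_of_nnreal (shannon_h f X) = H1 (tgt (fst X)) - H1 (tgt f)"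
  by (metis real_of_shannon_h prod.collapse)

section \<open>Composition laws and the axioms for the Shannon entropy\<close>

lemma comp_arr_assoc:
  assumes "x \<in> FinProb" "src a = tgt x"
  shows "(g \<odot> a) \<odot> x = g \<odot> (a \<odot> x)"
  using assms by (auto simp: comp_arr_def compose_def FinProb_def fun_eq_iff)

lemma comp_ident:
  assumes "f \<in> FinProb"
  shows "ident (tgt f) \<odot> f = f" "f \<odot> ident (src f) = f"
  using assms
  by (cases f; auto simp: comp_arr_def compose_def ident_def FinProb_def fun_eq_iff PiE_def extensional_def)+

lemma ident_in_FinProb: "P \<in> FinProb_ob \<Longrightarrow> ident P \<in> FinProb"
proof -
  have "map_pmf (\<lambda>x\<in>set_pmf P. x) P = map_pmf id P" by (rule map_pmf_cong) auto
  then show "P \<in> FinProb_ob \<Longrightarrow> ident P \<in> FinProb" by (auto simp: ident_def FinProb_def)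
qed

lemma under_postcomp_in_under:
  assumes "g \<in> FinProb" "src g = tgt f" "X \<in> under_obs f"
  shows "under_postcomp g X \<in> under_obs (g \<odot> f)"
proof -
  obtain x a where [simp]: "X = (x, a)" by fastforce
  have x: "x \<in> FinProb" "a \<in> FinProb" "src a = tgt x" and s: "src x = src f" "tgt a = tgt f" "a \<odot> x = f"
    using assms by (auto simp: under_obs_def)
  show ?thesis
    using x s assms comp_arr_assoc[OF x(1,3), of g] comp_arr_in_FinProb[OF x(2), of g]
    by (simp add: under_obs_def) (simp add: comp_arr_def)
qed

text \<open>The facts \<open>nn\<close> move the axioms to real entropies. Submodularity is then
  \<open>H1_joint_pmf\<close> and additivity under conditional products is
  \<open>H1_cprod_pmf\<close>; functoriality and postcomposition telescope.\<close>

lemma cond_entropy_shannon: "cond_entropy (shannon_F :: 'u::pairing_universe arr \<Rightarrow> nnreal) shannon_h"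
proof
  note nn = less_eq_nnreal.rep_eq plus_nnreal.rep_eq zero_nnreal.rep_eq real_of_nnreal_inject[symmetric]
    real_of_shannon_F real_of_nnreal_shannon_h
  show "shannon_F (ident P) = 0" if "P \<in> FinProb_ob" for P :: "'u pmf"
    using ident_in_FinProb[OF that] by (simp add: nn) (simp add: ident_def)
  show "shannon_F (g \<odot> f) = shannon_F g + shannon_F f"
    if "f \<in> FinProb" "g \<in> FinProb" "src g = tgt f" for f g :: "'u arr"
    using that by (simp add: nn comp_arr_in_FinProb) (simp add: comp_arr_def)
  show "shannon_h f X' \<le> shannon_h f X"
    if "f \<in> FinProb" "X \<in> under_obs f" "X' \<in> under_obs f" "under_hom X X' \<noteq> {}"
    for f :: "'u arr" and X X'
  proof -
    obtain x a x' a' where [simp]: "X = (x, a)" "X' = (x', a')" by fastforce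
    have hom: "under_hom X X' \<noteq> {}" by (rule that(4))
    obtain g where "g \<in> FinProb" "src g = tgt x" "tgt g = tgt x'"
      using hom by auto
    then have "H1 (tgt x') \<le> H1 (tgt x)" using H1_mono[of g] by simp
    then show ?thesis using that by (simp add: nn del: shannon_h.simps)
  qed
  show "shannon_h f (under_prod X Y) \<le> shannon_h f X + shannon_h f Y"
    if "f \<in> FinProb" "X \<in> under_obs f" "Y \<in> under_obs f" for f :: "'u arr" and X Y
  proof -
    obtain x a y b where [simp]: "X = (x, a)" "Y = (y, b)" by fastforce
    show ?thesis
      using that H1_joint_pmf[of x a f y b] under_prod_in_under[OF that] by (simp add: nn del: shannon_h.simps)
  qed
  show "shannon_h f (under_unit f) \<le> 0" if "f \<in> FinProb" for f :: "'u arr"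
    by (simp add: under_unit_def less_eq_nnreal.rep_eq zero_nnreal.rep_eq Abs_nnreal_inverse)
  show "shannon_h f' (under_precomp X k) = shannon_h f X"
    if "f \<in> over_obs Q" "f' \<in> over_obs Q" "k \<in> over_hom f' f" "X \<in> under_obs f"
    for f f' :: "'u arr" and Q k X
    using that by (cases X) (simp add: over_obs_def comp_arr_def)
  show "shannon_h (f1 \<otimes> f2) (under_tensor f1 f2 X1 X2) = shannon_h f1 X1 + shannon_h f2 X2"
    if f: "f1 \<in> over_obs Q" "f2 \<in> over_obs Q" and X: "X1 \<in> under_obs f1" "X2 \<in> under_obs f2"
    for f1 f2 :: "'u arr" and Q X1 X2
  proof -
    obtain x1 a1 x2 a2 where [simp]: "X1 = (x1, a1)" "X2 = (x2, a2)" by fastforce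
    have "a1 \<in> over_obs Q" "a2 \<in> over_obs Q" "tgt x1 = src a1" "tgt x2 = src a2"
      using f X by (auto simp: under_obs_def over_obs_def)
    then show ?thesis
      using X H1_cprod_pmf[of a1 Q a2] under_tensor_in_under[OF f X] f
      by (simp add: nn del: shannon_h.simps) (simp add: tensor_hom_def tensor_def over_obs_def)
  qed
  show "shannon_h (ident Q) (ident Q, ident Q) = 0" if "Q \<in> FinProb_ob" for Q :: "'u pmf"
    by (simp add: zero_nnreal_def)
  show "shannon_F g + shannon_h f X = shannon_h (g \<odot> f) (under_postcomp g X)"
    if "f \<in> FinProb" "g \<in> FinProb" "src g = tgt f" "X \<in> under_obs f" for f g :: "'u arr" and X
    using that under_postcomp_in_under[of g f X]
    by (cases X) (simp add: nn comp_arr_in_FinProb del: shannon_h.simps, simp add: comp_arr_def)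
qed

subsection \<open>Entropies of distributions on arbitrary types\<close>

text \<open>With the pushforward as target, measure preservation holds by construction, and only
  finiteness of the support remains to be checked.\<close>

definition arr_of :: "'u pmf \<Rightarrow> ('u \<Rightarrow> 'u) \<Rightarrow> 'u arr" where
  "arr_of P f = Arr P (map_pmf f P) (restrict f (set_pmf P))"

lemma src_arr_of [simp]: "src (arr_of P f) = P"
  and tgt_arr_of [simp]: "tgt (arr_of P f) = map_pmf f P"
  and app_arr_of: "app (arr_of P f) = restrict f (set_pmf P)"
  by (simp_all add: arr_of_def)

lemma arr_of_in_FinProb: "finite (set_pmf P) \<Longrightarrow> arr_of P f \<in> FinProb"
proof -
  have "map_pmf (restrict f (set_pmf P)) P = map_pmf f P" by (rule map_pmf_cong) auto
  then show "finite (set_pmf P) \<Longrightarrow> arr_of P f \<in> FinProb"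
    by (auto simp: arr_of_def FinProb_def FinProb_ob_def)
qed

lemma arr_of_comp: "arr_of (map_pmf f P) g \<odot> arr_of P f = arr_of P (g \<circ> f)"
  by (auto simp: arr_of_def comp_arr_def compose_def pmf.map_comp fun_eq_iff)

lemma arr_of_src_app: "f \<in> FinProb \<Longrightarrow> arr_of (src f) (app f) = f"
  by (cases f) (auto simp: arr_of_def FinProb_def PiE_def extensional_restrict)

lemma ex_inj_on_infinite:
  assumes "finite A"
  shows "\<exists>e :: 'a \<Rightarrow> 'u::infinite. inj_on e A"
proof -
  obtain B :: "'u set" where "finite B" "card B = card A"
    using infinite_arbitrarily_large[OF infinite_UNIV] by blast
  then obtain e where "bij_betw e A B" using finite_same_card_bij assms by metis
  then show ?thesis by (auto simp: bij_betw_def)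
qed

text \<open>Both sides have total mass 1, so a pointwise comparison on the support of one of them
  forces equality.\<close>

lemma pmf_eqI_le: "(\<And>x. x \<in> set_pmf P \<Longrightarrow> pmf P x \<le> pmf R x) \<Longrightarrow> P = R"
  by (metis pmf_neq_exists_less linorder_not_le pmf_nonneg set_pmf_iff)

text \<open>The law with marginal Q and conditional laws K. Up to relabelling, its first projection
  is an arbitrary finite map onto Q, with K as the disintegration.\<close>

definition dep_pair_pmf :: "'a pmf \<Rightarrow> ('a \<Rightarrow> 'b pmf) \<Rightarrow> ('a \<times> 'b) pmf" where
  "dep_pair_pmf Q K = bind_pmf Q (\<lambda>q. map_pmf (Pair q) (K q))"

lemma set_dep_pair_pmf [simp]: "set_pmf (dep_pair_pmf Q K) = (SIGMA q:set_pmf Q. set_pmf (K q))"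
  by (auto simp: dep_pair_pmf_def)

lemma map_fst_dep_pair_pmf [simp]: "map_pmf fst (dep_pair_pmf Q K) = Q"
  by (simp add: dep_pair_pmf_def map_bind_pmf map_pmf_comp bind_return_pmf')

lemma map_snd_dep_pair_pmf: "map_pmf snd (dep_pair_pmf Q K) = bind_pmf Q K"
  by (simp add: dep_pair_pmf_def map_bind_pmf map_pmf_comp)

lemma map_dep_pair_pmf:
  "map_pmf (\<lambda>(q, a). (f q, g q a)) (dep_pair_pmf Q K) = bind_pmf Q (\<lambda>q. map_pmf (\<lambda>a. (f q, g q a)) (K q))"
  by (simp add: dep_pair_pmf_def map_bind_pmf map_pmf_comp)

lemma dep_pair_map_pmf:
  assumes "inj_on e (set_pmf Q)"
  shows "dep_pair_pmf (map_pmf e Q) (\<lambda>q. map_pmf c (K (inv_into (set_pmf Q) e q))) =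
    map_pmf (map_prod e c) (dep_pair_pmf Q K)"
  using assms
  by (auto simp: dep_pair_pmf_def bind_map_pmf map_bind_pmf map_pmf_comp intro!: bind_pmf_cong map_pmf_cong)

lemma dep_pair_const_pmf: "dep_pair_pmf Q (\<lambda>_. K) = pair_pmf Q K"
  by (simp add: dep_pair_pmf_def pair_pmf_def map_pmf_def)

lemma pmf_dep_pair_pmf: "pmf (dep_pair_pmf Q K) (q, a) = pmf Q q * pmf (K q) a"
proof -
  have "pmf (dep_pair_pmf Q K) (q, a) =
      measure_pmf.expectation Q (\<lambda>q'. indicator {q} q' * pmf (K q) a)"
    unfolding dep_pair_pmf_def pmf_bind
    by (rule Bochner_Integration.integral_cong[OF refl])
       (auto simp: indicator_def pmf_map_inj' inj_on_def pmf_eq_0_set_pmf)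
  then show ?thesis by (simp add: measure_pmf_single)
qed

section \<open>Reduction of a conditional entropy to one function of distributions\<close>

context cond_entropy
begin

text \<open>The object (id, a) is the postcomposition with a of the tensor unit over the source of
  a, where h vanishes.\<close>

lemma h_ident_left:
  assumes "a \<in> FinProb"
  shows "h a (ident (src a), a) = F a"
proof -
  let ?i = "ident (src a)"
  have ob: "src a \<in> FinProb_ob" using assms by (simp add: FinProb_def)
  note i = ident_in_FinProb[OF ob]
  have s [simp]: "src ?i = src a" "tgt ?i = src a" by (simp_all add: ident_def)
  have "(?i, ?i) \<in> under_obs ?i" using i comp_ident[OF i] by (simp add: under_obs_def)
  then have "F a + h ?i (?i, ?i) = h (a \<odot> ?i) (under_postcomp a (?i, ?i))"
    using i assms by (intro h_postcomp) auto
  then show ?thesis by (simp add: h_tensor_unit[OF ob] comp_ident[OF assms])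
qed

text \<open>The object (x, a) is the precomposition of (id, a) with x, seen as a morphism from f to
  a over Q. Hence h does not depend on x.\<close>

lemma h_eq_F:
  assumes f: "f \<in> FinProb" and X: "(x, a) \<in> under_obs f"
  shows "h f (x, a) = F a"
proof -
  let ?i = "ident (src a)"
  have x: "x \<in> FinProb" "a \<in> FinProb" "src x = src f" "tgt x = src a" "tgt a = tgt f" "a \<odot> x = f"
    using X by (auto simp: under_obs_def)
  have "src a \<in> FinProb_ob" using x by (simp add: FinProb_def)
  note i = ident_in_FinProb[OF this]
  have "h f (under_precomp (?i, a) x) = h a (?i, a)"
    using x f i comp_ident[OF x(2)]
    by (intro h_precomp[of _ "tgt f"]) (auto simp: over_obs_def over_hom_def under_obs_def ident_def)
  then show ?thesis using h_ident_left[OF x(2)] comp_ident[OF x(1)] x by simp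
qed

text \<open>In the under category of g, the arrow g is a morphism from (id, g) to (g, id), whose
  values are F g and F id = 0.\<close>

lemma F_nonneg:
  assumes g: "g \<in> FinProb"
  shows "0 \<le> F g"
proof -
  have ob: "src g \<in> FinProb_ob" "tgt g \<in> FinProb_ob" using g by (simp_all add: FinProb_def)
  note i = ident_in_FinProb[OF ob(1)] ident_in_FinProb[OF ob(2)]
  have X: "(ident (src g), g) \<in> under_obs g" "(g, ident (tgt g)) \<in> under_obs g"
    using g i comp_ident[OF g] by (auto simp: under_obs_def) (auto simp: ident_def)
  have "g \<in> under_hom (ident (src g), g) (g, ident (tgt g))"
    using g comp_ident[OF g] by (simp add: ident_def)
  then have "h g (g, ident (tgt g)) \<le> h g (ident (src g), g)" using h_mono[OF g X] by blast
  then show ?thesis using h_eq_F[OF g X(1)] h_eq_F[OF g X(2)] F_ident[OF ob(2)] by simp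
qed

text \<open>The value of F on the map to a terminal object. The same point serves every P, so
  composites of such maps agree as arrows.\<close>

definition F_point :: "'u pmf \<Rightarrow> 'w" where
  "F_point P = F (arr_of P (\<lambda>_. undefined))"

text \<open>Functoriality along P, its pushforward, and the point. This is how F becomes a
  difference of entropies in the absence of subtraction.\<close>

lemma F_arr_of_add_F_point:
  assumes "finite (set_pmf P)"
  shows "F (arr_of P f) + F_point (map_pmf f P) = F_point P"
proof -
  have "F (arr_of (map_pmf f P) (\<lambda>_. undefined) \<odot> arr_of P f) =
      F (arr_of (map_pmf f P) (\<lambda>_. undefined)) + F (arr_of P f)"
    using assms by (intro F_comp arr_of_in_FinProb) simp_all
  then show ?thesis unfolding arr_of_comp by (simp add: F_point_def comp_def add.commute)
qed

lemma F_add_F_point: "f \<in> FinProb \<Longrightarrow> F f + F_point (tgt f) = F_point (src f)"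
  using F_arr_of_add_F_point[of "src f" "app f"] finite_FinProb[of f]
  by (simp add: arr_of_src_app FinProb_map_pmf)

lemma F_point_map_le: "finite (set_pmf P) \<Longrightarrow> F_point (map_pmf f P) \<le> F_point P"
  using add_right_mono[OF F_nonneg[OF arr_of_in_FinProb], of P "F_point (map_pmf f P)" f] F_arr_of_add_F_point[of P f]
  by simp

text \<open>Entropy decreases under maps, and an injection on the support has an inverse that maps
  back.\<close>

lemma F_point_map_inj:
  assumes fin: "finite (set_pmf P)" and inj: "inj_on f (set_pmf P)"
  shows "F_point (map_pmf f P) = F_point P"
proof (rule antisym)
  have "map_pmf (inv_into (set_pmf P) f) (map_pmf f P) = map_pmf id P"
    unfolding pmf.map_comp by (rule map_pmf_cong) (use inj in auto)
  then show "F_point P \<le> F_point (map_pmf f P)"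
    using F_point_map_le[of "map_pmf f P" "inv_into (set_pmf P) f"] fin by simp
qed (use fin in \<open>rule F_point_map_le\<close>)

text \<open>
  Transporting along an arbitrary injection into the universe, the entropy makes sense for
  distributions on any type.
\<close>

definition ent :: "'a pmf \<Rightarrow> 'w" where
  "ent P = F_point (map_pmf (SOME e. inj_on e (set_pmf P)) P)"

text \<open>Independence of the chosen injection: two injections of the support differ by an
  injection between their images.\<close>

lemma ent_eq_F_point:
  assumes fin: "finite (set_pmf P)" and inj: "inj_on e (set_pmf P)"
  shows "ent P = F_point (map_pmf e P)"
proof -
  define e' :: "'a \<Rightarrow> 'u" where "e' = (SOME e. inj_on e (set_pmf P))"
  have inj': "inj_on e' (set_pmf P)"
    unfolding e'_def by (rule someI_ex[OF ex_inj_on_infinite[OF fin]])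
  have "map_pmf e P = map_pmf (e \<circ> inv_into (set_pmf P) e') (map_pmf e' P)"
    unfolding pmf.map_comp by (rule map_pmf_cong) (use inj' in auto)
  moreover have "inj_on (e \<circ> inv_into (set_pmf P) e') (set_pmf (map_pmf e' P))"
    using inj inj' by (auto simp: inj_on_def)
  ultimately show ?thesis
    using F_point_map_inj[of "map_pmf e' P" "e \<circ> inv_into (set_pmf P) e'"] fin by (simp add: ent_def e'_def)
qed

lemma ent_F_point: "finite (set_pmf P) \<Longrightarrow> ent P = F_point P"
  using ent_eq_F_point[of P id] by simp

lemma ent_map_inj:
  assumes fin: "finite (set_pmf P)" and inj: "inj_on f (set_pmf P)"
  shows "ent (map_pmf f P) = ent P"
proof -
  obtain e :: "'b \<Rightarrow> 'u" where e: "inj_on e (f ` set_pmf P)"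
    using ex_inj_on_infinite fin by blast
  have "ent (map_pmf f P) = F_point (map_pmf e (map_pmf f P))"
    using fin e by (intro ent_eq_F_point) auto
  also have "\<dots> = F_point (map_pmf (e \<circ> f) P)" by (simp add: pmf.map_comp)
  also have "\<dots> = ent P"
    using fin e inj by (intro ent_eq_F_point[symmetric] comp_inj_on) auto
  finally show ?thesis .
qed

lemma ent_return [simp]: "ent (return_pmf x) = 0"
proof -
  have "ent (return_pmf x) = ent (return_pmf (undefined :: 'u))"
    using ent_map_inj[of "return_pmf x" "\<lambda>_. undefined :: 'u"] by simp
  \<comment> \<open>The map from the point mass at \<open>undefined\<close> to the terminal object
    is an identity arrow.\<close>
  also have "\<dots> = F (ident (return_pmf undefined))"
    by (simp add: ent_F_point F_point_def arr_of_def ident_def) (rule arg_cong[where f = F], auto)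
  also have "\<dots> = 0" by (rule F_ident) (simp add: FinProb_ob_def)
  finally show ?thesis .
qed

lemma ent_nonneg:
  assumes "finite (set_pmf P)"
  shows "0 \<le> ent P"
proof -
  obtain e :: "'a \<Rightarrow> 'u" where "inj_on e (set_pmf P)" using ex_inj_on_infinite[OF assms] by blast
  then show ?thesis using assms by (simp add: ent_eq_F_point F_point_def F_nonneg arr_of_in_FinProb)
qed

text \<open>Submodularity over the one-point base, applied to the two coordinates as random
  variables. Their joint variable is the identity of the encoded law P.\<close>

lemma ent_subadd:
  assumes fin: "finite (set_pmf R)"
  shows "ent R \<le> ent (map_pmf fst R) + ent (map_pmf snd R)"
proof -
  obtain e1 :: "'a \<Rightarrow> 'u" where e1: "inj_on e1 (fst ` set_pmf R)"
    using ex_inj_on_infinite fin by blast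
  obtain e2 :: "'b \<Rightarrow> 'u" where e2: "inj_on e2 (snd ` set_pmf R)"
    using ex_inj_on_infinite fin by blast
  define P where "P = map_pmf (\<lambda>z. pair (map_prod e1 e2 z)) R"
  define x where "x = arr_of P (\<lambda>z. fst (unpair z))"
  define y where "y = arr_of P (\<lambda>z. snd (unpair z))"
  define c :: "'u \<Rightarrow> 'u" where "c = (\<lambda>_. undefined)"
  define f where "f = arr_of P c"
  define a where "a = arr_of (tgt x) c"
  define b where "b = arr_of (tgt y) c"
  have finP: "finite (set_pmf P)" using fin by (simp add: P_def)
  have ent_R: "ent R = F_point P"
    unfolding P_def
  proof (rule ent_eq_F_point[OF fin], rule inj_onI)
    fix z w assume zw: "z \<in> set_pmf R" "w \<in> set_pmf R" "pair (map_prod e1 e2 z) = pair (map_prod e1 e2 w)"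
    then have "e1 (fst z) = e1 (fst w)" "e2 (snd z) = e2 (snd w)"
      by (auto simp: inj_eq[OF inj_pair] map_prod_def split: prod.splits)
    from inj_onD[OF e1 this(1)] inj_onD[OF e2 this(2)]
    have "fst z = fst w" "snd z = snd w" using zw(1,2) by simp_all
    then show "z = w" by (rule prod_eqI)
  qed
  have f: "f \<in> FinProb" unfolding f_def by (rule arr_of_in_FinProb[OF finP])
  have x: "x \<in> FinProb" "y \<in> FinProb" "a \<in> FinProb" "b \<in> FinProb"
    unfolding x_def y_def a_def b_def using finP by (auto intro!: arr_of_in_FinProb)
  have c_comp: "c \<circ> g = c" for g by (simp add: c_def comp_def)
  have X: "(x, a) \<in> under_obs f" "(y, b) \<in> under_obs f"
    using x by (simp_all add: under_obs_def a_def b_def f_def x_def y_def arr_of_comp c_comp pmf.map_comp)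
  have J: "joint_pmf x y = P"
  proof -
    have "joint_pmf x y = map_pmf (\<lambda>p. p) P"
      unfolding joint_pmf_def x_def y_def src_arr_of
      by (rule map_pmf_cong) (auto simp: app_arr_of P_def)
    then show ?thesis by simp
  qed
  \<comment> \<open>The joint variable lies over the point by the map f itself, so
    \<open>h_eq_F\<close> evaluates h at the product as F f.\<close>
  have snd_prod: "snd (under_prod (x, a) (y, b)) = f"
  proof -
    have "app a u = undefined" for u by (simp add: a_def app_arr_of c_def restrict_def)
    moreover have "tgt a = map_pmf c P" by (simp add: a_def x_def pmf.map_comp c_comp)
    ultimately show ?thesis by (simp add: J f_def arr_of_def c_def restrict_def)
  qed
  have "h f (under_prod (x, a) (y, b)) \<le> h f (x, a) + h f (y, b)"
    by (rule h_prod[OF f X])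
  moreover have "h f (under_prod (x, a) (y, b)) = F f"
    using h_eq_F[OF f, of "fst (under_prod (x, a) (y, b))" "snd (under_prod (x, a) (y, b))"]
      under_prod_in_under[OF f X] snd_prod by simp
  ultimately have "F f \<le> F a + F b" using h_eq_F[OF f] X by simp
  moreover have "F f = F_point P" by (simp add: f_def F_point_def c_def)
  moreover have "F a = ent (map_pmf fst R)"
  proof -
    have "tgt x = map_pmf e1 (map_pmf fst R)" by (simp add: x_def P_def pmf.map_comp comp_def)
    then show ?thesis using ent_eq_F_point[of "map_pmf fst R" e1] fin e1 by (simp add: a_def F_point_def c_def)
  qed
  moreover have "F b = ent (map_pmf snd R)"
  proof -
    have "tgt y = map_pmf e2 (map_pmf snd R)" by (simp add: y_def P_def pmf.map_comp comp_def)
    then show ?thesis using ent_eq_F_point[of "map_pmf snd R" e2] fin e2 by (simp add: b_def F_point_def c_def)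
  qed
  ultimately show ?thesis using ent_R by simp
qed

text \<open>Additivity of h on the objects (id, f1) and (id, f2), where \<open>h_eq_F\<close>
  replaces h by F.\<close>

lemma F_tensor:
  assumes f: "f1 \<in> over_obs Q" "f2 \<in> over_obs Q"
  shows "F (f1 \<otimes> f2) = F f1 + F f2"
proof -
  have i: "f \<in> FinProb \<Longrightarrow> (ident (src f), f) \<in> under_obs f" for f
    using ident_in_FinProb[of "src f"] comp_ident[of f]
    by (auto simp: under_obs_def FinProb_def) (auto simp: ident_def)
  let ?i1 = "ident (src f1)" and ?i2 = "ident (src f2)"
  have F: "f1 \<in> FinProb" "f2 \<in> FinProb" using f by (auto simp: over_obs_def)
  have T: "f1 \<otimes> f2 \<in> FinProb" using tensor_in_over[OF f] by (simp add: over_obs_def)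
  note X = i[OF F(1)] i[OF F(2)]
  have "h (f1 \<otimes> f2) (under_tensor f1 f2 (?i1, f1) (?i2, f2)) = h f1 (?i1, f1) + h f2 (?i2, f2)"
    by (rule h_tensor[OF f X])
  then show ?thesis
    using h_eq_F[OF T, of "tensor_hom f1 f2 f1 f2 ?i1 ?i2" "f1 \<otimes> f2"] h_eq_F[OF F(1) X(1)] h_eq_F[OF F(2) X(2)]
      under_tensor_in_under[OF f X] by simp
qed

lemma F_point_cprod_pmf:
  assumes f: "f1 \<in> over_obs Q" "f2 \<in> over_obs Q"
  shows "F_point (cprod_pmf f1 f2) + F_point Q = F_point (src f1) + F_point (src f2)"
proof -
  have T: "f1 \<otimes> f2 \<in> FinProb" "tgt f1 = Q" "tgt f2 = Q" "f1 \<in> FinProb" "f2 \<in> FinProb"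
    using tensor_in_over[OF f] f by (auto simp: over_obs_def)
  have s: "src (f1 \<otimes> f2) = cprod_pmf f1 f2" "tgt (f1 \<otimes> f2) = Q" using T by (simp_all add: tensor_def)
  have "F_point (cprod_pmf f1 f2) + F_point Q = (F f1 + F_point Q) + (F f2 + F_point Q)"
    by (simp add: F_add_F_point[OF T(1), unfolded s, symmetric] F_tensor[OF f] add_ac)
  then show ?thesis using F_add_F_point[OF T(4)] F_add_F_point[OF T(5)] T by simp
qed

text \<open>The conditional product over Q of the two first projections has the products of the
  fibres as its fibres.\<close>

lemma ent_dep_pair_universe:
  fixes Q :: "'u pmf" and K1 K2 :: "'u \<Rightarrow> 'u pmf"
  assumes Q: "finite (set_pmf Q)" and K: "\<And>q. q \<in> set_pmf Q \<Longrightarrow> finite (set_pmf (K1 q))"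
    "\<And>q. q \<in> set_pmf Q \<Longrightarrow> finite (set_pmf (K2 q))"
  shows "ent (dep_pair_pmf Q (\<lambda>q. pair_pmf (K1 q) (K2 q))) + ent Q =
    ent (dep_pair_pmf Q K1) + ent (dep_pair_pmf Q K2)"
proof -
  let ?D = "dep_pair_pmf Q (\<lambda>q. pair_pmf (K1 q) (K2 q))"
  define P where "P K = map_pmf pair (dep_pair_pmf Q K)" for K :: "'u \<Rightarrow> 'u pmf"
  define f where "f K = arr_of (P K) (\<lambda>z. fst (unpair z))" for K
  have fin: "finite (set_pmf (P K1))" "finite (set_pmf (P K2))" using Q K by (auto simp: P_def)
  have f: "f K1 \<in> over_obs Q" "f K2 \<in> over_obs Q"
    using fin by (auto simp: over_obs_def f_def arr_of_in_FinProb)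
      (simp_all add: P_def map_pmf_comp)
  \<comment> \<open>Reproduces the encoding of the fibre product, in which both components carry a
    copy of the base point.\<close>
  define r :: "'u \<times> 'u \<times> 'u \<Rightarrow> 'u" where "r = (\<lambda>(q, a, b). pair (pair (q, a), pair (q, b)))"
  have inj: "inj_on r A" for A by (auto simp: r_def inj_on_def inj_eq[OF inj_pair])
  have "map_pmf r ?D = cprod_pmf (f K1) (f K2)"
  proof (rule pmf_eqI_le)
    fix z assume "z \<in> set_pmf (map_pmf r ?D)"
    then obtain q a b where z: "z = r (q, a, b)"
      and q: "q \<in> set_pmf Q" "a \<in> set_pmf (K1 q)" "b \<in> set_pmf (K2 q)"
      by auto
    have mem: "pair (q, a) \<in> set_pmf (P K1)" "pair (q, b) \<in> set_pmf (P K2)"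
      using q by (auto simp: P_def)
    have "pmf (map_pmf r ?D) z = pmf Q q * (pmf (K1 q) a * pmf (K2 q) b)"
      unfolding z using q by (subst pmf_map_inj[OF inj]) (auto simp: pmf_dep_pair_pmf pmf_pair)
    also have "\<dots> = pmf (cprod_pmf (f K1) (f K2)) z"
      unfolding z r_def prod.case pmf_cprod_pmf[OF f] using mem q
      by (simp add: f_def app_arr_of)
         (simp add: P_def pmf_map_inj'[OF inj_pair] pmf_dep_pair_pmf set_pmf_iff)
    finally show "pmf (map_pmf r ?D) z \<le> pmf (cprod_pmf (f K1) (f K2)) z" by simp
  qed
  then have "ent ?D = F_point (cprod_pmf (f K1) (f K2))"
    using ent_eq_F_point[of ?D r] inj Q K by simp
  moreover have "ent (dep_pair_pmf Q K1) = F_point (P K1)" "ent (dep_pair_pmf Q K2) = F_point (P K2)"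
    unfolding P_def using Q K by (intro ent_eq_F_point inj_on_subset[OF inj_pair]; simp)+
  ultimately show ?thesis
    using F_point_cprod_pmf[OF f] Q by (simp add: ent_F_point f_def)
qed

lemma ent_dep_pair:
  assumes Q: "finite (set_pmf Q)" and K: "\<And>q. q \<in> set_pmf Q \<Longrightarrow> finite (set_pmf (K1 q))"
    "\<And>q. q \<in> set_pmf Q \<Longrightarrow> finite (set_pmf (K2 q))"
  shows "ent (dep_pair_pmf Q (\<lambda>q. pair_pmf (K1 q) (K2 q))) + ent Q =
    ent (dep_pair_pmf Q K1) + ent (dep_pair_pmf Q K2)"
proof -
  let ?D = "dep_pair_pmf Q (\<lambda>q. pair_pmf (K1 q) (K2 q))"
  obtain e :: "'a \<Rightarrow> 'u" where e: "inj_on e (set_pmf Q)" using ex_inj_on_infinite[OF Q] by blast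
  \<comment> \<open>Injectivity on the union of all fibres lets one relabelling serve every
    q.\<close>
  obtain e1 :: "'b \<Rightarrow> 'u" where e1: "inj_on e1 (\<Union>q\<in>set_pmf Q. set_pmf (K1 q))"
    using ex_inj_on_infinite Q K by (metis finite_UN)
  obtain e2 :: "'c \<Rightarrow> 'u" where e2: "inj_on e2 (\<Union>q\<in>set_pmf Q. set_pmf (K2 q))"
    using ex_inj_on_infinite Q K by (metis finite_UN)
  let ?i = "inv_into (set_pmf Q) e"
  let ?L1 = "\<lambda>q. map_pmf e1 (K1 (?i q))" and ?L2 = "\<lambda>q. map_pmf e2 (K2 (?i q))"
  have pr: "pair_pmf (?L1 q) (?L2 q) = map_pmf (map_prod e1 e2) (pair_pmf (K1 (?i q)) (K2 (?i q)))" for q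
    by (simp add: map_pair[symmetric] map_prod_def)
  have "ent (dep_pair_pmf (map_pmf e Q) (\<lambda>q. pair_pmf (?L1 q) (?L2 q))) + ent (map_pmf e Q) =
      ent (dep_pair_pmf (map_pmf e Q) ?L1) + ent (dep_pair_pmf (map_pmf e Q) ?L2)"
    using Q K e by (intro ent_dep_pair_universe) auto
  moreover have "ent (dep_pair_pmf (map_pmf e Q) (\<lambda>q. pair_pmf (?L1 q) (?L2 q))) = ent ?D"
    unfolding pr dep_pair_map_pmf[OF e, where K = "\<lambda>q. pair_pmf (K1 q) (K2 q)"]
    using Q K e e1 e2 by (intro ent_map_inj) (auto simp: inj_on_def)
  moreover have "ent (dep_pair_pmf (map_pmf e Q) ?L1) = ent (dep_pair_pmf Q K1)"
    unfolding dep_pair_map_pmf[OF e] using Q K e e1 by (intro ent_map_inj) (auto simp: inj_on_def)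
  moreover have "ent (dep_pair_pmf (map_pmf e Q) ?L2) = ent (dep_pair_pmf Q K2)"
    unfolding dep_pair_map_pmf[OF e] using Q K e e2 by (intro ent_map_inj) (auto simp: inj_on_def)
  moreover have "ent (map_pmf e Q) = ent Q" using Q e by (rule ent_map_inj)
  ultimately show ?thesis by simp
qed

end

subsection \<open>Finitely supported distributions: rational approximation and range of entropy\<close>

lemma dep_pair_pmf_cong:
  "(\<And>q. q \<in> set_pmf Q \<Longrightarrow> K q = K' q) \<Longrightarrow> dep_pair_pmf Q K = dep_pair_pmf Q K'"
  unfolding dep_pair_pmf_def by (rule bind_pmf_cong) simp_all

lemma map_apfst_dep_pair_pmf:
  "map_pmf (apfst e) (dep_pair_pmf Q (\<lambda>q. K (e q))) = dep_pair_pmf (map_pmf e Q) K"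
  by (simp add: dep_pair_pmf_def bind_map_pmf map_bind_pmf map_pmf_comp)

lemma ex_pmf_weights:
  fixes w :: "'a \<Rightarrow> real"
  assumes fin: "finite S" and nn: "\<And>x. x \<in> S \<Longrightarrow> 0 \<le> w x" and sum: "sum w S = 1"
  shows "\<exists>P. \<forall>x. pmf P x = (if x \<in> S then w x else 0)"
proof -
  let ?w = "\<lambda>x. if x \<in> S then w x else 0"
  have "(\<integral>\<^sup>+x. ennreal (?w x) \<partial>count_space UNIV) = (\<Sum>x\<in>S. ennreal (?w x))"
    using fin by (intro nn_integral_count_space') auto
  also have "\<dots> = 1" using nn sum by (simp add: sum_ennreal)
  finally have "pmf (embed_pmf ?w) x = ?w x" for x
    using nn by (intro pmf_embed_pmf) auto
  then show ?thesis by blast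
qed

definition rational_pmf :: "'a pmf \<Rightarrow> bool" where
  "rational_pmf P \<longleftrightarrow> finite (set_pmf P) \<and>
     (\<exists>N>0. \<exists>k :: 'a \<Rightarrow> nat. \<forall>x. pmf P x * real N = real (k x))"

lemma rational_approximation:
  assumes fin: "finite (set_pmf P)"
  obtains p where "\<And>n. rational_pmf (p n)" "\<And>n. set_pmf (p n) = set_pmf P"
    "\<And>x. (\<lambda>n. pmf (p n) x) \<longlonglongrightarrow> pmf P x"
proof -
  let ?S = "set_pmf P"
  \<comment> \<open>Adding 1 to the rounded numerators keeps every support point charged, so the
    support is unchanged; after division by n it vanishes in the limit.\<close>
  define k where "k n x = nat \<lfloor>real n * pmf P x\<rfloor> + 1" for n x
  define N where "N n = (\<Sum>x\<in>?S. k n x)" for n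
  have N: "N n > 0" for n
    unfolding N_def using fin by (intro sum_pos) (auto simp: k_def set_pmf_not_empty)
  have "\<exists>p. \<forall>x. pmf p x = (if x \<in> ?S then k n x / N n else 0)" for n
    using N[of n] fin by (intro ex_pmf_weights) (simp_all flip: sum_divide_distrib of_nat_sum add: N_def[symmetric])
  then obtain p where p: "\<And>n x. pmf (p n) x = (if x \<in> ?S then k n x / N n else 0)" by metis
  have set_p: "set_pmf (p n) = ?S" for n
    using N[of n] by (auto simp: set_pmf_iff p) (simp add: k_def)
  have "rational_pmf (p n)" for n
    unfolding rational_pmf_def set_p using fin N[of n]
    by (intro conjI exI[of _ "N n"] exI[of _ "\<lambda>x. if x \<in> ?S then k n x else 0"]) (auto simp: p)
  moreover have "(\<lambda>n. pmf (p n) x) \<longlonglongrightarrow> pmf P x" for x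
  proof (cases "x \<in> ?S")
    case True
    have k: "(\<lambda>n. k n y / n) \<longlonglongrightarrow> pmf P y" for y
    proof (rule tendsto_sandwich)
      show "\<forall>\<^sub>F n in sequentially. pmf P y \<le> k n y / n"
        using eventually_gt_at_top[of 0]
      proof eventually_elim
        case (elim n)
        have "real n * pmf P y \<le> k n y" unfolding k_def by (simp; linarith)
        then show ?case using elim by (simp add: field_simps)
      qed
      show "\<forall>\<^sub>F n in sequentially. k n y / n \<le> pmf P y + 1 / n"
        using eventually_gt_at_top[of 0]
      proof eventually_elim
        case (elim n)
        have "real (k n y) \<le> real n * pmf P y + 1" unfolding k_def by simp
        then show ?case using elim by (simp add: field_simps)
      qed
      show "(\<lambda>n. pmf P y + 1 / real n) \<longlonglongrightarrow> pmf P y" by real_asymp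
    qed simp
    have "(\<lambda>n. \<Sum>y\<in>?S. k n y / n) \<longlonglongrightarrow> (\<Sum>y\<in>?S. pmf P y)" by (intro tendsto_sum k)
    then have "(\<lambda>n. N n / n) \<longlonglongrightarrow> 1" using fin by (simp add: N_def sum_divide_distrib sum_pmf_eq_1)
    then have "(\<lambda>n. (k n x / n) / (N n / n)) \<longlonglongrightarrow> pmf P x / 1" by (intro tendsto_divide k) simp_all
    moreover have "\<forall>\<^sub>F n in sequentially. (k n x / n) / (N n / n) = pmf (p n) x"
      using eventually_gt_at_top[of 0] by eventually_elim (use True in \<open>simp add: p\<close>)
    ultimately show ?thesis by (auto intro: Lim_transform_eventually)
  qed (simp add: p set_pmf_iff)
  ultimately show ?thesis using that set_p by blast
qed

lemma tendsto_H1: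
  assumes fin: "finite (set_pmf P)" and set: "\<And>n. set_pmf (p n) = set_pmf P"
    and lim: "\<And>x. (\<lambda>n. pmf (p n) x) \<longlonglongrightarrow> pmf P x"
  shows "(\<lambda>n. H1 (p n)) \<longlonglongrightarrow> H1 P"
  unfolding H1_def set by (intro tendsto_intros lim) (simp add: set_pmf_iff)

text \<open>Intermediate value theorem along laws giving mass t to each of n points and the rest to
  one more. They run from a point mass to the uniform law on n + 1 points, whose entropy ln (1 + n)
  is at least r.\<close>

lemma ex_pmf_H1:
  assumes "0 \<le> r"
  shows "\<exists>P :: nat pmf. finite (set_pmf P) \<and> H1 P = r"
proof -
  obtain n :: nat where n: "exp r \<le> n" using real_arch_simple by blast
  have "0 < real n" using n exp_gt_zero[of r] by linarith
  define c where "c = 1 / (1 + real n)"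
  define H :: "real \<Rightarrow> real"
    where "H t = - (real n * (t * ln t) + (1 - real n * t) * ln (1 - real n * t))" for t :: real
  have c: "0 < c" "n * c < 1" by (simp_all add: c_def field_simps)
  have "1 - n * c = c" by (simp add: c_def field_simps)
  then have "H c = - (n * (c * ln c) + c * ln c)" by (simp only: H_def)
  also have "\<dots> = - ((1 + n) * c * ln c)" by (simp add: algebra_simps)
  also have "\<dots> = ln (1 + n)" by (simp add: c_def ln_div)
  finally have Hc: "r \<le> H c"
    using n \<open>0 < real n\<close> by (simp add: ln_ge_iff)
  have pos: "0 < 1 - n * t" if "t \<le> c" for t :: real
    using mult_left_mono[OF that, of n] c by simp
  \<comment> \<open>The convention ln 0 = 0 makes the value at t = 0 agree with the limit of t ln
    t.\<close>
  have xlnx: "continuous_on {0..c} (\<lambda>t::real. t * ln t)"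
  proof (rule continuous_on_IccI)
    show "((\<lambda>t::real. t * ln t) \<longlongrightarrow> 0 * ln 0) (at_right 0)" by real_asymp
    show "((\<lambda>t::real. t * ln t) \<longlongrightarrow> c * ln c) (at_left c)"
      by (intro tendsto_intros) (use c in auto)
    show "((\<lambda>t::real. t * ln t) \<longlongrightarrow> x * ln x) (at x)" if "0 < x" "x < c" for x
      by (intro tendsto_intros) (use that in auto)
  qed (use c in simp)
  have "continuous_on {0..c} H"
    unfolding H_def by (intro continuous_intros xlnx) (use pos in force)
  then obtain t where t: "0 \<le> t" "t \<le> c" "H t = r"
    using IVT'[of H 0 r c] Hc c assms by (auto simp: H_def)
  let ?w = "\<lambda>i. if i = 0 then 1 - n * t else t"
  have split: "{..n} = insert 0 {1..n}" by auto
  have "\<exists>P. \<forall>i. pmf P i = (if i \<in> {..n} then ?w i else 0)"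
    using pos[OF t(2)] t by (intro ex_pmf_weights) (auto simp: split)
  then obtain P where P: "\<And>i. pmf P i = (if i \<in> {..n} then ?w i else 0)" by blast
  have sub: "set_pmf P \<subseteq> {..n}" by (auto simp: set_pmf_iff P split: if_splits)
  have "H1 P = H t" by (subst H1_superset[OF _ sub]) (simp_all add: P H_def split)
  then show ?thesis using t sub finite_subset by blast
qed

lemma H1_pair_pmf:
  assumes fin: "finite (set_pmf P)" "finite (set_pmf R)"
  shows "H1 (pair_pmf P R) = H1 P + H1 R"
proof -
  let ?D = "pair_pmf P R"
  have fD: "finite (set_pmf ?D)" using fin by simp
  have "H1 ?D = - (\<Sum>z\<in>set_pmf ?D. pmf ?D z * (ln (pmf P (fst z)) + ln (pmf R (snd z))))"
    unfolding H1_def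
    by (rule arg_cong[where f = uminus], rule sum.cong) (auto simp: pmf_pair ln_mult_pos pmf_positive)
  also have "\<dots> = H1 P + H1 R"
    using H1_map[OF fD, of fst] H1_map[OF fD, of snd]
    by (simp add: map_fst_pair_pmf map_snd_pair_pmf distrib_left sum.distrib)
  finally show ?thesis .
qed

lemma rational_pmfE:
  assumes "rational_pmf P"
  obtains k :: "'a \<Rightarrow> nat" and N where "\<And>x. x \<in> set_pmf P \<Longrightarrow> 0 < k x" "0 < N"
    "N = (\<Sum>x\<in>set_pmf P. k x)" "\<And>x. x \<in> set_pmf P \<Longrightarrow> pmf P x = k x / N"
proof -
  obtain N and k :: "'a \<Rightarrow> nat" where N: "0 < N" and k: "\<And>x. pmf P x * real N = real (k x)"
    and fin: "finite (set_pmf P)"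
    using assms by (auto simp: rational_pmf_def)
  have "real N = (\<Sum>x\<in>set_pmf P. pmf P x * real N)"
    unfolding sum_distrib_right[symmetric] using fin by (simp add: sum_pmf_eq_1)
  also have "\<dots> = real (\<Sum>x\<in>set_pmf P. k x)" by (simp add: k)
  finally have "N = (\<Sum>x\<in>set_pmf P. k x)" by linarith
  moreover have "0 < k x" if "x \<in> set_pmf P" for x
    using k[of x] N that by (metis mult_pos_pos of_nat_0_less_iff pmf_positive)
  moreover have "pmf P x = k x / N" for x using k[of x] N by (simp add: field_simps)
  ultimately show ?thesis using that N by blast
qed

text \<open>Isolates one nontrivial fibre. An arbitrary finite family of fibres is assembled from
  these by conditional products.\<close>

definition fibre_at :: "'a \<Rightarrow> 'b pmf \<Rightarrow> 'a \<Rightarrow> 'b pmf" where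
  "fibre_at i K = (\<lambda>q. if q = i then K else return_pmf undefined)"

subsection \<open>Chain rule, concavity, and comparison with the Shannon entropy\<close>

context cond_entropy
begin

lemma ent_dep_pair_unit:
  "finite (set_pmf K) \<Longrightarrow> ent (dep_pair_pmf (return_pmf ()) (\<lambda>_. K)) = ent K"
  by (simp add: dep_pair_const_pmf pair_return_pmf1 ent_map_inj inj_on_def)

lemma ent_pair:
  assumes "finite (set_pmf P)" "finite (set_pmf R)"
  shows "ent (pair_pmf P R) = ent P + ent R"
  using ent_dep_pair[of "return_pmf ()" "\<lambda>_. P" "\<lambda>_. R"] assms
  by (simp add: ent_dep_pair_unit)

text \<open>Induction on A by \<open>ent_dep_pair\<close>: over each q at most one factor is
  nontrivial, so the conditional product merely adds the fibre at i. Each product costs one more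
  entropy of Q.\<close>

lemma ent_dep_pair_fibres:
  assumes Q: "finite (set_pmf Q)" and A: "finite A" and K: "\<And>q. finite (set_pmf (K q))"
  shows "ent (dep_pair_pmf Q (\<lambda>q. if q \<in> A then K q else return_pmf undefined)) + card A \<circledast> ent Q =
    (\<Sum>i\<in>A. ent (dep_pair_pmf Q (fibre_at i (K i)))) + ent Q"
  using A
proof (induction A)
  case empty
  show ?case using Q by (simp add: dep_pair_const_pmf pair_return_pmf2 ent_map_inj inj_on_def)
next
  case (insert i A)
  define L where "L A = (\<lambda>q. if q \<in> A then K q else return_pmf undefined)" for A
  \<comment> \<open>Keeps the one fibre coordinate that can be nontrivial over q.\<close>
  define r :: "'a \<times> 'b \<times> 'b \<Rightarrow> 'a \<times> 'b" where "r = (\<lambda>(q, a, b). (q, if q = i then b else a))"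
  let ?D = "dep_pair_pmf Q (\<lambda>q. pair_pmf (L A q) (fibre_at i (K i) q))"
  have fin: "finite (set_pmf (L A q))" "finite (set_pmf (fibre_at i (K i) q))" for A q
    using K by (auto simp: L_def fibre_at_def)
  have "map_pmf r ?D = bind_pmf Q (\<lambda>q. map_pmf (\<lambda>(a, b). (q, if q = i then b else a))
      (pair_pmf (L A q) (fibre_at i (K i) q)))"
    using map_dep_pair_pmf[of "\<lambda>q. q" "\<lambda>q (a, b). if q = i then b else a" Q
        "\<lambda>q. pair_pmf (L A q) (fibre_at i (K i) q)"]
    by (simp add: r_def case_prod_unfold)
  also have "\<dots> = dep_pair_pmf Q (L (insert i A))"
    unfolding dep_pair_pmf_def using insert.hyps
    by (intro bind_pmf_cong refl)
       (auto simp: L_def fibre_at_def pair_return_pmf1 pair_return_pmf2 map_pmf_comp)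
  finally have "ent (dep_pair_pmf Q (L (insert i A))) = ent (map_pmf r ?D)" by simp
  also have "\<dots> = ent ?D"
    using Q fin insert.hyps
    by (intro ent_map_inj) (auto simp: inj_on_def r_def L_def fibre_at_def split: if_splits)
  finally have eq: "ent (dep_pair_pmf Q (L (insert i A))) + ent Q =
      ent (dep_pair_pmf Q (L A)) + ent (dep_pair_pmf Q (fibre_at i (K i)))"
    using ent_dep_pair[OF Q fin] by simp
  have "ent (dep_pair_pmf Q (L (insert i A))) + card (insert i A) \<circledast> ent Q =
      (ent (dep_pair_pmf Q (L (insert i A))) + ent Q) + card A \<circledast> ent Q"
    using insert.hyps by (simp add: add.assoc)
  also have "\<dots> = (ent (dep_pair_pmf Q (L A)) + card A \<circledast> ent Q) + ent (dep_pair_pmf Q (fibre_at i (K i)))"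
    unfolding eq by (simp add: add_ac)
  also have "ent (dep_pair_pmf Q (L A)) + card A \<circledast> ent Q =
      (\<Sum>i\<in>A. ent (dep_pair_pmf Q (fibre_at i (K i)))) + ent Q"
    using insert.IH by (simp only: L_def)
  finally show ?case
    using insert.hyps unfolding L_def by (simp add: add_ac)
qed

text \<open>Transpositions of the uniform base make all positions contribute equally, and with P in
  every fibre the total is the entropy of a product law.\<close>

lemma ent_fibre_at_uniform:
  assumes I: "finite I" "i \<in> I" and P: "finite (set_pmf P)"
  shows "card I \<circledast> ent (dep_pair_pmf (pmf_of_set I) (fibre_at i P)) = ent P + card I \<circledast> ent (pmf_of_set I)"
proof -
  let ?Q = "pmf_of_set I"
  have ne: "I \<noteq> {}" using I by auto
  have Q: "set_pmf ?Q = I" "finite (set_pmf ?Q)" using I ne by auto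
  have sym: "ent (dep_pair_pmf ?Q (fibre_at j P)) = ent (dep_pair_pmf ?Q (fibre_at i P))" if "j \<in> I" for j
  proof -
    let ?t = "Transposition.transpose i j"
    have t: "?t ` I = I" using I that by (auto simp: image_iff Transposition.transpose_def split: if_splits; metis)
    have inj: "inj ?t" by (metis injI transpose_involutory)
    then have "inj_on ?t I" by (rule inj_on_subset) simp
    then have "map_pmf ?t ?Q = ?Q" using map_pmf_of_set_inj[OF _ ne I(1), of ?t] t by simp
    moreover have "fibre_at j P (?t q) = fibre_at i P q" for q
      by (auto simp: fibre_at_def Transposition.transpose_def)
    ultimately have "dep_pair_pmf ?Q (fibre_at j P) = map_pmf (apfst ?t) (dep_pair_pmf ?Q (fibre_at i P))"
      using map_apfst_dep_pair_pmf[of ?t ?Q "fibre_at j P"] by simp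
    then show ?thesis
      using Q P inj
      by (simp only:) (rule ent_map_inj, simp add: fibre_at_def, rule inj_on_subset[of _ UNIV], simp_all)
  qed
  have "ent (dep_pair_pmf ?Q (\<lambda>q. if q \<in> I then P else return_pmf undefined)) + card I \<circledast> ent ?Q =
      (\<Sum>j\<in>I. ent (dep_pair_pmf ?Q (fibre_at j P))) + ent ?Q"
    by (rule ent_dep_pair_fibres) (use Q I P in auto)
  also have "dep_pair_pmf ?Q (\<lambda>q. if q \<in> I then P else return_pmf undefined) = pair_pmf ?Q P"
    unfolding dep_pair_const_pmf[symmetric] by (rule dep_pair_pmf_cong) (simp add: Q)
  also have "(\<Sum>j\<in>I. ent (dep_pair_pmf ?Q (fibre_at j P))) = card I \<circledast> ent (dep_pair_pmf ?Q (fibre_at i P))"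
    unfolding sum_const_nmult[symmetric] by (rule sum.cong[OF refl sym])
  finally have "(ent P + card I \<circledast> ent ?Q) + ent ?Q = card I \<circledast> ent (dep_pair_pmf ?Q (fibre_at i P)) + ent ?Q"
    using Q P by (simp add: ent_pair add_ac)
  then show ?thesis by (simp add: ic_add_eq_cancel)
qed

text \<open>The chain rule over a uniform base, multiplied by the number of points to clear
  denominators.\<close>

lemma ent_dep_pair_uniform:
  assumes I: "finite I" "I \<noteq> {}" and K: "\<And>i. finite (set_pmf (K i))"
  shows "card I \<circledast> ent (dep_pair_pmf (pmf_of_set I) K) = card I \<circledast> ent (pmf_of_set I) + (\<Sum>i\<in>I. ent (K i))"
proof -
  let ?Q = "pmf_of_set I" and ?N = "card I"
  have Q: "set_pmf ?Q = I" "finite (set_pmf ?Q)" using I by auto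
  have "dep_pair_pmf ?Q K = dep_pair_pmf ?Q (\<lambda>q. if q \<in> I then K q else return_pmf undefined)"
    by (rule dep_pair_pmf_cong) (simp add: Q)
  then have eq: "ent (dep_pair_pmf ?Q K) + ?N \<circledast> ent ?Q =
      (\<Sum>i\<in>I. ent (dep_pair_pmf ?Q (fibre_at i (K i)))) + ent ?Q"
    using ent_dep_pair_fibres[OF Q(2) I(1) K] by simp
  \<comment> \<open>A second factor N is what \<open>ent_fibre_at_uniform\<close> requires of each
    summand; the surplus base entropy then cancels.\<close>
  have "?N \<circledast> ent (dep_pair_pmf ?Q K) + ?N \<circledast> ?N \<circledast> ent ?Q =
      (\<Sum>i\<in>I. ?N \<circledast> ent (dep_pair_pmf ?Q (fibre_at i (K i)))) + ?N \<circledast> ent ?Q"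
    using arg_cong[OF eq, of "nmult ?N"] by (simp add: nmult_add_right nmult_sum)
  also have "(\<Sum>i\<in>I. ?N \<circledast> ent (dep_pair_pmf ?Q (fibre_at i (K i)))) = (\<Sum>i\<in>I. ent (K i) + ?N \<circledast> ent ?Q)"
    by (rule sum.cong[OF refl]) (rule ent_fibre_at_uniform[OF I(1) _ K])
  also have "\<dots> = (\<Sum>i\<in>I. ent (K i)) + ?N \<circledast> ?N \<circledast> ent ?Q"
    by (simp add: sum.distrib sum_const_nmult)
  finally have "?N \<circledast> ent (dep_pair_pmf ?Q K) + ?N \<circledast> ?N \<circledast> ent ?Q =
      (?N \<circledast> ent ?Q + (\<Sum>i\<in>I. ent (K i))) + ?N \<circledast> ?N \<circledast> ent ?Q"
    by (simp add: add_ac)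
  then show ?thesis by (simp only: ic_add_eq_cancel)
qed

text \<open>Conditioning reduces entropy: subadditivity bounds the joint law of index and sample,
  the chain rule computes it, and the entropy of the index cancels.\<close>

lemma ent_concave:
  assumes I: "finite I" "I \<noteq> {}" and K: "\<And>i. finite (set_pmf (K i))"
  shows "(\<Sum>i\<in>I. ent (K i)) \<le> card I \<circledast> ent (bind_pmf (pmf_of_set I) K)"
proof -
  let ?Q = "pmf_of_set I" and ?N = "card I"
  have "finite (set_pmf (dep_pair_pmf ?Q K))" using I K by simp
  from ent_subadd[OF this]
  have "ent (dep_pair_pmf ?Q K) \<le> ent ?Q + ent (bind_pmf ?Q K)" by (simp add: map_snd_dep_pair_pmf)
  from nmult_mono[OF this, of ?N]
  have "?N \<circledast> ent ?Q + (\<Sum>i\<in>I. ent (K i)) \<le> ?N \<circledast> ent ?Q + ?N \<circledast> ent (bind_pmf ?Q K)"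
    unfolding ent_dep_pair_uniform[OF assms] by (simp add: nmult_add_right)
  then show ?thesis by (simp only: ic_add_le_cancel_left)
qed

section \<open>Entropies of uniform distributions, the analogue of ln n\<close>

definition hartley :: "nat \<Rightarrow> 'w" where
  "hartley n = ent (pmf_of_set {..<n})"

lemma ent_pmf_of_set:
  assumes A: "finite A" "A \<noteq> {}"
  shows "ent (pmf_of_set A) = hartley (card A)"
proof -
  obtain e where e: "bij_betw e A {..<card A}"
    using ex_bij_betw_finite_nat[OF A(1)] by (auto simp: atLeast0LessThan)
  then have "map_pmf e (pmf_of_set A) = pmf_of_set {..<card A}"
    using A by (intro map_pmf_of_set_bij_betw)
  then show ?thesis
    using ent_map_inj[of "pmf_of_set A" e] A e by (simp add: hartley_def bij_betw_def)
qed

lemma hartley_nonneg: "0 < n \<Longrightarrow> 0 \<le> hartley n"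
  unfolding hartley_def by (rule ent_nonneg) (simp add: lessThan_empty_iff)

lemma hartley_1 [simp]: "hartley (Suc 0) = 0"
  using ent_pmf_of_set[of "{0::nat}"] by (simp add: pmf_of_set_singleton)

lemma hartley_mult:
  assumes "0 < m" "0 < n"
  shows "hartley (m * n) = hartley m + hartley n"
proof -
  let ?A = "{..<m}" and ?B = "{..<n}"
  have "pair_pmf (pmf_of_set ?A) (pmf_of_set ?B) = pmf_of_set (?A \<times> ?B)"
    using assms by (intro pmf_eqI) (auto simp: pmf_pair indicator_def lessThan_empty_iff)
  then have "hartley m + hartley n = ent (pmf_of_set (?A \<times> ?B))"
    using ent_pair[of "pmf_of_set ?A" "pmf_of_set ?B"] assms by (simp add: hartley_def lessThan_empty_iff)
  also have "\<dots> = hartley (m * n)" using assms by (subst ent_pmf_of_set) (auto simp: lessThan_empty_iff)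
  finally show ?thesis by simp
qed

lemma hartley_power: "0 < n \<Longrightarrow> hartley (n ^ k) = k \<circledast> hartley n"
  by (induction k) (simp_all add: hartley_mult)

lemma hartley_prod: "(\<And>i. i \<in> A \<Longrightarrow> 0 < f i) \<Longrightarrow> hartley (\<Prod>i\<in>A. f i) = (\<Sum>i\<in>A. hartley (f i))"
  by (induction A rule: infinite_finite_induct) (simp_all add: hartley_mult prod_pos)

text \<open>The uniform distribution on \<open>n + 1\<close> points is the average of those omitting one point.\<close>

lemma hartley_le_Suc:
  assumes n: "0 < n"
  shows "hartley n \<le> hartley (Suc n)"
proof -
  let ?I = "{..<Suc n}"
  \<comment> \<open>Indices outside the range get a point mass, since \<open>ent_concave\<close>
    asks for finite support at every index.\<close>
  define K where "K i = pmf_of_set (if i \<in> ?I then ?I - {i} else {0})" for i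
  have card: "card (?I - {i}) = n" if "i \<in> ?I" for i using that by simp
  have ne: "?I - {i} \<noteq> {}" if "i \<in> ?I" for i using card[OF that] n by (metis card.empty less_irrefl)
  have fin: "finite (set_pmf (K i))" for i using ne[of i] by (auto simp: K_def)
  have K: "pmf (K i) x = (if x \<in> ?I - {i} then 1 / n else 0)" if "i \<in> ?I" for i x
    using that ne[OF that] card[OF that] by (simp add: K_def indicator_def)
  have "bind_pmf (pmf_of_set ?I) K = pmf_of_set ?I"
  proof (rule pmf_eqI)
    fix x
    have "(\<Sum>i\<in>?I. pmf (K i) x) = (\<Sum>i\<in>?I. if x \<in> ?I - {i} then 1 / real n else 0)"
      by (rule sum.cong[OF refl]) (rule K)
    \<comment> \<open>A point x in the range is charged by the n laws that omit some other point,
      each with mass 1 / n.\<close>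
    also have "\<dots> = (\<Sum>i\<in>(if x \<in> ?I then ?I - {x} else {}). 1 / real n)"
      by (rule sum.mono_neutral_cong_right) (auto split: if_splits)
    also have "\<dots> = (if x \<in> ?I then 1 else 0)" using n card[of x] by simp
    finally show "pmf (bind_pmf (pmf_of_set ?I) K) x = pmf (pmf_of_set ?I) x"
      by (subst pmf_bind_pmf_of_set) (auto simp: indicator_def lessThan_empty_iff)
  qed
  then have "(\<Sum>i\<in>?I. ent (K i)) \<le> Suc n \<circledast> hartley (Suc n)"
    using ent_concave[of ?I K] fin by (simp add: hartley_def lessThan_empty_iff)
  also have "(\<Sum>i\<in>?I. ent (K i)) = (\<Sum>i\<in>?I. hartley n)"
    using ne card by (intro sum.cong) (simp_all add: K_def ent_pmf_of_set)
  finally have "Suc n \<circledast> hartley n \<le> Suc n \<circledast> hartley (Suc n)" by (simp add: sum_const_nmult)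
  then show ?thesis
    by (rule nmult_le_cancel) (use n in \<open>simp_all add: hartley_nonneg\<close>)
qed

lemma hartley_mono:
  assumes "0 < m" "m \<le> n"
  shows "hartley m \<le> hartley n"
  using assms(2)
proof (induction n rule: dec_induct)
  case (step n)
  then show ?case using hartley_le_Suc[of n] assms(1) by (auto intro: order_trans)
qed simp

text \<open>
  The uniform distribution on \<open>N\<close> points lies over \<open>P\<close> with uniform fibres of sizes \<open>k x\<close>.
  Pulling this map back along itself makes the base uniform, so that
  \<open>ent_dep_pair_uniform\<close> applies.
\<close>

lemma ent_rational:
  assumes S: "finite S" "set_pmf P = S" and k: "\<And>x. x \<in> S \<Longrightarrow> 0 < k x"
    and N: "N = (\<Sum>x\<in>S. k x)" and P: "\<And>x. x \<in> S \<Longrightarrow> pmf P x = k x / N"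
  shows "N \<circledast> hartley N = (\<Sum>x\<in>S. k x \<circledast> hartley (k x)) + N \<circledast> ent P"
proof -
  define I where "I = (SIGMA x:S. {..<k x})"
  define K where "K x = pmf_of_set {..<if x \<in> S then k x else 1}" for x
  have ne: "{..<if x \<in> S then k x else 1} \<noteq> {}" for x using k[of x] by (auto simp: lessThan_empty_iff)
  have K: "finite (set_pmf (K x))" for x using ne[of x] by (auto simp: K_def)
  have I: "finite I" "card I = N" "I \<noteq> {}"
    using S k set_pmf_not_empty[of P] by (auto simp: I_def N lessThan_empty_iff)
  have D: "dep_pair_pmf P K = pmf_of_set I"
  proof (rule pmf_eqI)
    fix z :: "'a \<times> nat"
    obtain x j where z: "z = (x, j)" by fastforce
    show "pmf (dep_pair_pmf P K) z = pmf (pmf_of_set I) z"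
    proof (cases "x \<in> S")
      case True
      then show ?thesis
        using I ne[of x] k[of x] P[of x] S
        by (auto simp: z pmf_dep_pair_pmf K_def indicator_def I_def)
    next
      case False
      then show ?thesis using S I by (auto simp: z pmf_dep_pair_pmf I_def set_pmf_iff)
    qed
  qed
  define r :: "'a \<times> nat \<times> nat \<Rightarrow> ('a \<times> nat) \<times> nat" where "r = (\<lambda>(x, i, j). ((x, i), j))"
  let ?E = "dep_pair_pmf P (\<lambda>x. pair_pmf (K x) (K x))"
  \<comment> \<open>Reassociation: the first two coordinates are uniform on I, and the third is a
    further draw from the same fibre.\<close>
  have "map_pmf r ?E = dep_pair_pmf (pmf_of_set I) (\<lambda>z. K (fst z))"
    unfolding D[symmetric] dep_pair_pmf_def r_def
    by (simp add: map_bind_pmf bind_assoc_pmf bind_map_pmf map_pmf_comp pair_pmf_def)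
       (simp add: map_pmf_def bind_assoc_pmf bind_return_pmf)
  then have "ent (dep_pair_pmf (pmf_of_set I) (\<lambda>z. K (fst z))) = ent (map_pmf r ?E)" by simp
  also have "\<dots> = ent ?E" using S K by (intro ent_map_inj) (auto simp: inj_on_def r_def)
  finally have E: "ent (dep_pair_pmf (pmf_of_set I) (\<lambda>z. K (fst z))) + ent P = hartley N + hartley N"
    using ent_dep_pair[of P K K] S K I by (simp add: D ent_pmf_of_set)
  have "(\<Sum>z\<in>I. ent (K (fst z))) = (\<Sum>x\<in>S. \<Sum>j<k x. ent (K x))"
    unfolding I_def using S by (subst sum.Sigma) (auto simp: case_prod_unfold)
  also have "\<dots> = (\<Sum>x\<in>S. k x \<circledast> hartley (k x))"
    by (rule sum.cong) (simp_all add: sum_const_nmult K_def hartley_def)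
  finally have "N \<circledast> ent (dep_pair_pmf (pmf_of_set I) (\<lambda>z. K (fst z))) =
      N \<circledast> hartley N + (\<Sum>x\<in>S. k x \<circledast> hartley (k x))"
    using ent_dep_pair_uniform[OF I(1,3), of "\<lambda>z. K (fst z)"] K I by (simp add: ent_pmf_of_set)
  then have "N \<circledast> hartley N + (N \<circledast> hartley N) =
      N \<circledast> hartley N + ((\<Sum>x\<in>S. k x \<circledast> hartley (k x)) + N \<circledast> ent P)"
    using arg_cong[OF E, of "nmult N"] by (simp add: nmult_add_right add_ac)
  then show ?thesis by (simp only: ic_add_eq_cancel_left)
qed

section \<open>Cuts at rational multiples of the entropy of a fair bit\<close>

lemma hartley_le_of_ln:
  assumes "0 < m" "0 < n" "ln (real m) \<le> ln (real n)"
  shows "hartley m \<le> hartley n"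
  using assms by (intro hartley_mono) simp_all

text \<open>Multiplied by N and exponentiated, the real inequality compares the integers L and R.
  Monotonicity and multiplicativity of \<open>hartley\<close> carry this comparison over, and the
  terms coming from the fibres cancel.\<close>

lemma ent_rational_cut:
  assumes "rational_pmf P"
  shows "real a * H1 P \<le> real b * ln 2 \<Longrightarrow> a \<circledast> ent P \<le> b \<circledast> hartley 2"
    and "real b * ln 2 \<le> real a * H1 P \<Longrightarrow> b \<circledast> hartley 2 \<le> a \<circledast> ent P"
proof -
  let ?S = "set_pmf P"
  obtain k :: "'a \<Rightarrow> nat" and N where k: "\<And>x. x \<in> ?S \<Longrightarrow> 0 < k x" and N0: "0 < N"
    and N: "N = (\<Sum>x\<in>?S. k x)" and P: "\<And>x. x \<in> ?S \<Longrightarrow> pmf P x = k x / N"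
    by (rule rational_pmfE[OF assms]) metis
  have fin: "finite ?S" using assms by (simp add: rational_pmf_def)
  define L where "L = N ^ (a * N)"
  define R where "R = 2 ^ (b * N) * (\<Prod>x\<in>?S. k x ^ (a * k x))"
  have pos: "0 < L" "0 < R" using N0 k by (auto simp: L_def R_def intro!: prod_pos)
  have "real N * H1 P = - (\<Sum>x\<in>?S. real (k x) * (ln (k x) - ln N))"
    unfolding H1_def using N0 k
    by (simp add: sum_distrib_left P ln_div)
  also have "\<dots> = real N * ln N - (\<Sum>x\<in>?S. real (k x) * ln (k x))"
    by (simp add: right_diff_distrib sum_subtractf N sum_distrib_right)
  finally have H: "real N * H1 P = real N * ln N - (\<Sum>x\<in>?S. real (k x) * ln (k x))" .
  have lnR: "ln (real R) = real (b * N) * ln 2 + a * (\<Sum>x\<in>?S. real (k x) * ln (k x))"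
  proof -
    have "ln (\<Prod>x\<in>?S. real (k x) ^ (a * k x)) = (\<Sum>x\<in>?S. a * (real (k x) * ln (k x)))"
      using k fin by (subst ln_prod) (simp_all add: ln_realpow mult.assoc)
    moreover have "0 < (\<Prod>x\<in>?S. real (k x) ^ (a * k x))" using k by (intro prod_pos) simp
    ultimately show ?thesis by (simp add: R_def ln_mult_pos ln_realpow sum_distrib_left)
  qed
  have "ln (real L) - ln (real R) = real N * (a * H1 P - b * ln 2)"
    unfolding lnR right_diff_distrib mult.left_commute[of "real N" "real a"] H
    by (simp add: L_def ln_realpow N0 algebra_simps)
  then have lr: "a * H1 P \<le> b * ln 2 \<Longrightarrow> ln (real L) \<le> ln (real R)"
    "b * ln 2 \<le> a * H1 P \<Longrightarrow> ln (real R) \<le> ln (real L)"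
    using N0 mult_le_0_iff[of "real N" "a * H1 P - b * ln 2"] zero_le_mult_iff[of "real N" "a * H1 P - b * ln 2"]
    by auto
  let ?s = "\<Sum>x\<in>?S. (a * k x) \<circledast> hartley (k x)"
  have hL: "hartley L = ?s + N \<circledast> a \<circledast> ent P"
    using ent_rational[OF fin refl k N P] N0
    by (simp add: L_def hartley_power nmult_mult nmult_add_right nmult_sum nmult_left_commute[of N])
  have hR: "hartley R = ?s + N \<circledast> b \<circledast> hartley 2"
    using k by (simp add: R_def hartley_mult hartley_power hartley_prod prod_pos add.commute
        nmult_mult nmult_left_commute[of N])
  note nn = nmult_nonneg[OF ent_nonneg[OF fin]] nmult_nonneg[OF hartley_nonneg]
  show "a \<circledast> ent P \<le> b \<circledast> hartley 2" if "a * H1 P \<le> b * ln 2"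
    using hartley_le_of_ln[OF pos lr(1)[OF that]] N0 nn
    by - (rule nmult_le_cancel[of N], simp_all add: hL hR ic_add_le_cancel_left)
  show "b \<circledast> hartley 2 \<le> a \<circledast> ent P" if "b * ln 2 \<le> a * H1 P"
    using hartley_le_of_ln[OF pos(2,1) lr(2)[OF that]] N0 nn
    by - (rule nmult_le_cancel[of N], simp_all add: hL hR ic_add_le_cancel_left)
qed

text \<open>P is the average of m copies of P' and one residual law R, whose weights the hypothesis
  makes nonnegative. Concavity applies, and the entropy of R is dropped.\<close>

lemma ent_le_of_pmf_le:
  assumes fin: "finite (set_pmf P)" "finite (set_pmf P')"
    and le: "\<And>x. real m * pmf P' x \<le> real (Suc m) * pmf P x"
  shows "m \<circledast> ent P' \<le> Suc m \<circledast> ent P"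
proof -
  let ?S = "set_pmf P \<union> set_pmf P'"
  let ?w = "\<lambda>x. real (Suc m) * pmf P x - real m * pmf P' x"
  have "sum ?w ?S = real (Suc m) * (\<Sum>x\<in>?S. pmf P x) - real m * (\<Sum>x\<in>?S. pmf P' x)"
    by (simp only: sum_subtractf sum_distrib_left)
  also have "\<dots> = 1" using fin by (simp add: sum_pmf_eq_1)
  finally have "\<exists>R. \<forall>x. pmf R x = (if x \<in> ?S then ?w x else 0)"
    using fin le by (intro ex_pmf_weights) auto
  then obtain R where "\<And>x. pmf R x = (if x \<in> ?S then ?w x else 0)" by blast
  then have R: "pmf R x = ?w x" for x by (auto simp: set_pmf_iff)
  have "set_pmf R \<subseteq> ?S" by (auto simp: set_pmf_iff R)
  then have finR: "finite (set_pmf R)" using fin finite_subset by blast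
  define K where "K i = (if i = m then R else P')" for i
  have "bind_pmf (pmf_of_set {..<Suc m}) K = P"
  proof (rule pmf_eqI)
    fix x
    have "(\<Sum>i<Suc m. pmf (K i) x) = ?w x + real m * pmf P' x"
      by (simp add: K_def R)
    then show "pmf (bind_pmf (pmf_of_set {..<Suc m}) K) x = pmf P x"
      by (subst pmf_bind_pmf_of_set) (auto simp: lessThan_empty_iff field_simps)
  qed
  moreover have "(\<Sum>i<Suc m. ent (K i)) \<le> card {..<Suc m} \<circledast> ent (bind_pmf (pmf_of_set {..<Suc m}) K)"
    using fin finR by (intro ent_concave) (auto simp: K_def lessThan_empty_iff)
  moreover have "(\<Sum>i<Suc m. ent (K i)) = m \<circledast> ent P' + ent R"
    by (simp add: K_def sum_const_nmult)
  ultimately have "m \<circledast> ent P' + ent R \<le> Suc m \<circledast> ent P" by simp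
  moreover have "m \<circledast> ent P' \<le> m \<circledast> ent P' + ent R"
    using add_left_mono[OF ent_nonneg[OF finR], of "m \<circledast> ent P'"] by simp
  ultimately show ?thesis by (rule order_trans[rotated])
qed

text \<open>A strict inequality leaves room for a factor (m + 1) / m, which pays for replacing P by
  a rational law close to it.\<close>

lemma ent_cut:
  assumes fin: "finite (set_pmf P)"
  shows "real a * H1 P < real b * ln 2 \<Longrightarrow> a \<circledast> ent P \<le> b \<circledast> hartley 2"
    and "real b * ln 2 < real a * H1 P \<Longrightarrow> b \<circledast> hartley 2 \<le> a \<circledast> ent P"
proof -
  obtain p where p: "\<And>n. rational_pmf (p n)" and set: "\<And>n. set_pmf (p n) = set_pmf P"
    and lim: "\<And>x. (\<lambda>n. pmf (p n) x) \<longlonglongrightarrow> pmf P x"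
    using rational_approximation[OF fin] by metis
  note limH = tendsto_H1[OF fin set lim]
  have finp: "finite (set_pmf (p n))" for n using fin set by simp
  have off: "pmf P x = 0" "pmf (p n) x = 0" if "x \<notin> set_pmf P" for x n
    using that set[of n] by (auto simp: set_pmf_iff)
  note nn = nmult_nonneg[OF ent_nonneg[OF fin]] nmult_nonneg[OF hartley_nonneg]
  show "a \<circledast> ent P \<le> b \<circledast> hartley 2" if lt: "a * H1 P < b * ln 2"
  proof -
    obtain m :: nat where "real m * (b * ln 2 - a * H1 P) > a * H1 P"
      using reals_Archimedean3[of "b * ln 2 - a * H1 P"] lt by auto
    then have m: "real (a * Suc m) * H1 P < real (b * m) * ln 2" by (simp add: algebra_simps)
    then have m0: "0 < m" using H1_nonneg[of P] by (cases m) (auto simp: mult_less_0_iff)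
    have "\<forall>\<^sub>F n in sequentially. real (a * Suc m) * H1 (p n) < real (b * m) * ln 2"
      by (rule order_tendstoD(2)[OF tendsto_mult[OF tendsto_const limH] m])
    moreover have "\<forall>\<^sub>F n in sequentially. \<forall>x\<in>set_pmf P. real m * pmf P x < real (Suc m) * pmf (p n) x"
    proof (intro eventually_ball_finite[OF fin] ballI)
      fix x assume "x \<in> set_pmf P"
      then have "real m * pmf P x < real (Suc m) * pmf P x" by (simp add: pmf_positive)
      then show "\<forall>\<^sub>F n in sequentially. real m * pmf P x < real (Suc m) * pmf (p n) x"
        by (rule order_tendstoD(1)[OF tendsto_mult[OF tendsto_const lim]])
    qed
    ultimately have "\<exists>n. real (a * Suc m) * H1 (p n) < real (b * m) * ln 2 \<and>
        (\<forall>x\<in>set_pmf P. real m * pmf P x < real (Suc m) * pmf (p n) x)"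
      by (rule eventually_happens'[OF sequentially_bot eventually_conj])
    then obtain n where n: "real (a * Suc m) * H1 (p n) < real (b * m) * ln 2"
      "\<And>x. x \<in> set_pmf P \<Longrightarrow> real m * pmf P x < real (Suc m) * pmf (p n) x"
      by blast
    have "m \<circledast> ent P \<le> Suc m \<circledast> ent (p n)"
    proof (rule ent_le_of_pmf_le[OF finp fin])
      show "real m * pmf P x \<le> real (Suc m) * pmf (p n) x" for x
        by (cases "x \<in> set_pmf P") (use n(2)[of x] off in auto)
    qed
    then have "a \<circledast> m \<circledast> ent P \<le> a \<circledast> Suc m \<circledast> ent (p n)" by (rule nmult_mono)
    also have "\<dots> \<le> (b * m) \<circledast> hartley 2"
      unfolding nmult_mult[symmetric] using n by (intro ent_rational_cut p) simp
    finally have "m \<circledast> a \<circledast> ent P \<le> m \<circledast> b \<circledast> hartley 2"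
      by (simp only: nmult_left_commute[of m a] nmult_left_commute[of m b] nmult_mult)
    then show ?thesis by (rule nmult_le_cancel) (use m0 nn in simp_all)
  qed
  show "b \<circledast> hartley 2 \<le> a \<circledast> ent P" if lt: "b * ln 2 < a * H1 P"
  proof -
    obtain m :: nat where "real m * (a * H1 P - b * ln 2) > b * ln 2"
      using reals_Archimedean3[of "a * H1 P - b * ln 2"] lt by auto
    then have m: "real (b * Suc m) * ln 2 < real (a * m) * H1 P" by (simp add: algebra_simps)
    have "\<forall>\<^sub>F n in sequentially. real (b * Suc m) * ln 2 < real (a * m) * H1 (p n)"
      by (rule order_tendstoD(1)[OF tendsto_mult[OF tendsto_const limH] m])
    \<comment> \<open>For the lower cut P must dominate the approximation up to the factor, so the
      roles of P and \<open>p n\<close> are exchanged.\<close>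
    moreover have "\<forall>\<^sub>F n in sequentially. \<forall>x\<in>set_pmf P. real m * pmf (p n) x < real (Suc m) * pmf P x"
    proof (intro eventually_ball_finite[OF fin] ballI)
      fix x assume "x \<in> set_pmf P"
      then have "real m * pmf P x < real (Suc m) * pmf P x" by (simp add: pmf_positive)
      then show "\<forall>\<^sub>F n in sequentially. real m * pmf (p n) x < real (Suc m) * pmf P x"
        by (rule order_tendstoD(2)[OF tendsto_mult[OF tendsto_const lim]])
    qed
    ultimately have "\<exists>n. real (b * Suc m) * ln 2 < real (a * m) * H1 (p n) \<and>
        (\<forall>x\<in>set_pmf P. real m * pmf (p n) x < real (Suc m) * pmf P x)"
      by (rule eventually_happens'[OF sequentially_bot eventually_conj])
    then obtain n where n: "real (b * Suc m) * ln 2 < real (a * m) * H1 (p n)"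
      "\<And>x. x \<in> set_pmf P \<Longrightarrow> real m * pmf (p n) x < real (Suc m) * pmf P x"
      by blast
    have le: "m \<circledast> ent (p n) \<le> Suc m \<circledast> ent P"
    proof (rule ent_le_of_pmf_le[OF fin finp])
      show "real m * pmf (p n) x \<le> real (Suc m) * pmf P x" for x
        by (cases "x \<in> set_pmf P") (use n(2)[of x] off in auto)
    qed
    have "(b * Suc m) \<circledast> hartley 2 \<le> a \<circledast> m \<circledast> ent (p n)"
      unfolding nmult_mult[symmetric] using n by (intro ent_rational_cut p) simp
    also have "\<dots> \<le> a \<circledast> Suc m \<circledast> ent P" by (rule nmult_mono[OF le])
    finally have "Suc m \<circledast> b \<circledast> hartley 2 \<le> Suc m \<circledast> a \<circledast> ent P"
      by (simp only: nmult_left_commute[of "Suc m" a] nmult_left_commute[of "Suc m" b] nmult_mult)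
    then show ?thesis by (rule nmult_le_cancel) (use nn in simp_all)
  qed
qed

text \<open>For each n, n H1(P) is bracketed between consecutive multiples of ln 2. The two cuts
  then compare n-fold entropies up to two fair bits, an error independent of n.\<close>

lemma ent_le_of_H1_le:
  assumes fin: "finite (set_pmf P)" "finite (set_pmf R)" and le: "H1 P \<le> H1 R"
  shows "ent P \<le> ent R"
proof (rule ic_leI)
  fix n :: nat
  define b where "b = nat \<lfloor>n * H1 P / ln 2\<rfloor>"
  have "0 \<le> n * H1 P / ln 2" by (simp add: H1_nonneg)
  then have "b \<le> n * H1 P / ln 2" "n * H1 P / ln 2 < Suc b"
    unfolding b_def by (simp_all, linarith)
  then have b: "b * ln 2 \<le> n * H1 P" "n * H1 P < Suc b * ln 2"
    by (simp_all only: pos_le_divide_eq pos_divide_less_eq ln_gt_zero one_less_numeral_iff semiring_norm)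
  have h: "0 \<le> hartley 2" by (rule hartley_nonneg) simp
  \<comment> \<open>Lowering b by one gives the strict inequality that \<open>ent_cut\<close>
    demands; for b = 0 the truncated difference is 0.\<close>
  have "(b - 1) \<circledast> hartley 2 \<le> n \<circledast> ent R"
  proof (cases b)
    case 0
    then show ?thesis using nmult_nonneg[OF ent_nonneg[OF fin(2)]] by simp
  next
    case (Suc c)
    have "real c * ln 2 < real b * ln 2" using Suc by simp
    also have "\<dots> \<le> n * H1 R" using b(1) mult_left_mono[OF le, of n] by simp
    finally show ?thesis using ent_cut(2)[OF fin(2)] Suc by simp
  qed
  have "n \<circledast> ent P + 0 \<le> Suc b \<circledast> hartley 2" using ent_cut(1)[OF fin(1) b(2)] by simp
  also have "\<dots> \<le> ((b - 1) + 2) \<circledast> hartley 2" by (rule nmult_mono_left[OF h]) simp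
  also have "\<dots> \<le> n \<circledast> ent R + 2 \<circledast> hartley 2"
    unfolding nmult_add by (rule add_right_mono) fact
  finally show "n \<circledast> ent P + 0 \<le> n \<circledast> ent R + 2 \<circledast> hartley 2" .
qed

end

subsection \<open>Universality\<close>

text \<open>Surjectivity of \<open>shannon_F\<close> makes the mediating morphism unique.\<close>

lemma ex_shannon_F_eq:
  obtains f :: "'u::pairing_universe arr" where "f \<in> FinProb" "shannon_F f = r"
proof -
  obtain P :: "nat pmf" where P: "finite (set_pmf P)" "H1 P = real_of_nnreal r"
    using ex_pmf_H1[of "real_of_nnreal r"] real_of_nnreal[of r] by auto
  obtain e :: "nat \<Rightarrow> 'u" where e: "inj_on e (set_pmf P)" using ex_inj_on_infinite[OF P(1)] by blast
  let ?f = "arr_of (map_pmf e P) (\<lambda>_. undefined)"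
  have "shannon_F ?f = r"
    using P by (simp add: shannon_F_def H1_map_inj[OF e] map_pmf_const real_of_nnreal_inverse)
  moreover have "?f \<in> FinProb" using P by (intro arr_of_in_FinProb) simp
  ultimately show ?thesis by (rule that[rotated])
qed

context cond_entropy
begin

definition mediating :: "nnreal \<Rightarrow> 'w" where
  "mediating r = ent (SOME P :: nat pmf. finite (set_pmf P) \<and> H1 P = real_of_nnreal r)"

text \<open>Independence of the chosen law: equal Shannon entropies give inequalities both ways by
  \<open>ent_le_of_H1_le\<close>.\<close>

lemma mediating_eq:
  assumes fin: "finite (set_pmf P)" and H: "H1 P = real_of_nnreal r"
  shows "mediating r = ent P"
proof -
  define P' :: "nat pmf" where "P' = (SOME P. finite (set_pmf P) \<and> H1 P = real_of_nnreal r)"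
  have "finite (set_pmf P') \<and> H1 P' = real_of_nnreal r"
    unfolding P'_def by (rule someI_ex) (use ex_pmf_H1 real_of_nnreal[of r] in auto)
  then have "ent P' = ent P"
    using fin H by (intro antisym ent_le_of_H1_le) simp_all
  then show ?thesis by (simp add: mediating_def P'_def)
qed

lemma ex_pmf_nnreal: "\<exists>P :: nat pmf. finite (set_pmf P) \<and> H1 P = real_of_nnreal r"
  using ex_pmf_H1[of "real_of_nnreal r"] real_of_nnreal[of r] by simp

lemma ic_hom_mediating: "ic_hom mediating"
  unfolding ic_hom_def
proof (intro conjI allI monoI)
  show "mediating r \<le> mediating s" if "r \<le> s" for r s
  proof -
    obtain P R :: "nat pmf" where "finite (set_pmf P)" "H1 P = real_of_nnreal r"
      "finite (set_pmf R)" "H1 R = real_of_nnreal s"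
      using ex_pmf_nnreal by metis
    then show ?thesis
      using that ent_le_of_H1_le[of P R] by (simp add: mediating_eq[of P] mediating_eq[of R] less_eq_nnreal.rep_eq)
  qed
  show "mediating 0 = 0"
    using mediating_eq[of "return_pmf ()" 0] by (simp add: zero_nnreal.rep_eq)
  show "mediating (r + s) = mediating r + mediating s" for r s
  proof -
    obtain P R :: "nat pmf" where "finite (set_pmf P)" "H1 P = real_of_nnreal r"
      "finite (set_pmf R)" "H1 R = real_of_nnreal s"
      using ex_pmf_nnreal by metis
    then show ?thesis
      \<comment> \<open>The product of laws realizing r and s realizes r + s.\<close>
      using mediating_eq[of "pair_pmf P R" "r + s"]
      by (simp add: mediating_eq[of P] mediating_eq[of R] H1_pair_pmf ent_pair plus_nnreal.rep_eq)
  qed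
qed

text \<open>F f is only a difference of entropies, so the entropy of the target is added to both
  sides and cancelled at the end.\<close>

lemma F_eq_mediating:
  assumes f: "f \<in> FinProb"
  shows "F f = mediating (shannon_F f)"
proof -
  have fin: "finite (set_pmf (src f))" "finite (set_pmf (tgt f))" using finite_FinProb[OF f] by auto
  have H: "H1 P = real_of_nnreal (Abs_nnreal (H1 P))" for P :: "'u pmf"
    by (simp add: Abs_nnreal_inverse H1_nonneg)
  have "F f + ent (tgt f) = ent (src f)" using F_add_F_point[OF f] fin by (simp add: ent_F_point)
  also have "\<dots> = mediating (shannon_F f + Abs_nnreal (H1 (tgt f)))"
    using fin H[of "tgt f"] by (intro mediating_eq[symmetric]) (simp_all add: plus_nnreal.rep_eq real_of_shannon_F[OF f])
  also have "\<dots> = mediating (shannon_F f) + ent (tgt f)"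
    using ic_hom_mediating mediating_eq[OF fin(2) H] by (simp add: ic_hom_def)
  finally show ?thesis by (simp add: ic_add_eq_cancel)
qed

lemma h_eq_mediating:
  assumes "f \<in> FinProb" "X \<in> under_obs f"
  shows "h f X = mediating (shannon_h f X)"
proof -
  obtain x a where X: "X = (x, a)" by fastforce
  have "a \<in> FinProb" "tgt x = src a" "tgt a = tgt f" using assms X by (auto simp: under_obs_def)
  then show ?thesis
    using assms h_eq_F[of f x a] F_eq_mediating[of a] by (simp add: X shannon_F_def)
qed

end

theorem theorem29:
  shows "cond_entropy (shannon_F :: 'u::pairing_universe arr \<Rightarrow> nnreal) shannon_h \<and>
    (\<forall>(F' :: 'u arr \<Rightarrow> 'w::ic_ord_cmon) h'. cond_entropy F' h' \<longrightarrow>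
      (\<exists>!t. ic_hom t \<and>
        (\<forall>f\<in>FinProb. F' f = t (shannon_F f)) \<and>
        (\<forall>f\<in>FinProb. \<forall>X\<in>under_obs f. h' f X = t (shannon_h f X))))"
proof (intro conjI allI impI)
  show "cond_entropy (shannon_F :: 'u arr \<Rightarrow> nnreal) shannon_h"
    by (rule cond_entropy_shannon)
  fix F' :: "'u arr \<Rightarrow> 'w" and h'
  assume "cond_entropy F' h'"
  then interpret cond_entropy F' h' .
  show "\<exists>!t. ic_hom t \<and> (\<forall>f\<in>FinProb. F' f = t (shannon_F f)) \<and>
      (\<forall>f\<in>FinProb. \<forall>X\<in>under_obs f. h' f X = t (shannon_h f X))"
  proof (rule ex1I[of _ mediating])
    show "ic_hom mediating \<and> (\<forall>f\<in>FinProb. F' f = mediating (shannon_F f)) \<and>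
        (\<forall>f\<in>FinProb. \<forall>X\<in>under_obs f. h' f X = mediating (shannon_h f X))"
      using ic_hom_mediating F_eq_mediating h_eq_mediating by blast
  next
    fix t assume t: "ic_hom t \<and> (\<forall>f\<in>FinProb. F' f = t (shannon_F f)) \<and>
        (\<forall>f\<in>FinProb. \<forall>X\<in>under_obs f. h' f X = t (shannon_h f X))"
    show "t = mediating"
    proof
      fix r
      obtain f :: "'u arr" where "f \<in> FinProb" "shannon_F f = r" by (rule ex_shannon_F_eq)
      then show "t r = mediating r" using t F_eq_mediating by metis
    qed
  qed
qed

end
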